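(* Let $n\ge 1$, $I=[1,n]$, and let $q\in\mathbb{C}$ with $q\neq 0$ and $q^2\neq 1$. Let $S\in \mathrm{End}(\mathbb{C}^n)^{\otimes 2}$ be the braid matrix given in the context. A matrix $A\in\mathrm{End}(\mathbb{C}^n)$ satisfies the reflection equation $$S A_2 S A_2 = A_2 S A_2 S,\qquad A_2=1\otimes A,$$ if and only if it has the form $$A=\sum_{i\in I} x_i\, e^i_i + \sum_{j\in Y} y_j\, e^{\sigma(j)}_j ,$$ where the data are of one of the following two types. (Type 1) $(Y,\sigma)$ is an admissible pair of the form $$Y=[1,b_-]\cup[b_+,\,b_++b_--1],\qquad \sigma(i)=b_++b_--i\quad (i\in Y),$$ for some positive integers $b_-,b_+$ with $b_-<b_+$ and $b_-+b_+\le n+1$, and for some $\lambda,\mu\in\mathbb{C}$ $$x_i=\begin{cases}\lambda+\mu,& i\in[1,b_-],\\ \lambda,& i\in(b_-,b_+),\\ 0,& i\in[b_+,n],\end{cases}\qquad y_i\,y_{\sigma(i)}=-\lambda\mu\neq 0\quad (i\in Y).$$ (Type 2) $(Y,\sigma)$ is an admissible pair with $Y\cap\sigma(Y)=\emptyset$, and for some integer $b\in[b_-,b_+)$ (where $b_\pm$ are the integers associated with $(Y,\sigma)$ in the context) and some $\lambda\in\mathbb{C}$ $$x_i=\begin{cases}\lambda,& i\in[1,b],\\ 0,& i\in(b,n],\end{cases}\qquad y_i\neq 0\quad (i\in Y).$$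
   Context: Intervals are intervals of integers: $[a,b]=\{k\in\mathbb{Z}: a\le k\le b\}$, with parentheses for strict inequalities. $\{e^i_j\}_{i,j=1}^n$ is the standard basis of $\mathrm{End}(\mathbb{C}^n)$ with multiplication $e^i_je^l_k=\delta^l_j e^i_k$. Put $\omega=q-q^{-1}$. The braid matrix (associated with the fundamental vector representation of $U_q(gl(n))$) is $$S=\sum_{i,k=1}^n s_{ik}\,e^i_i\otimes e^k_k+\sum_{i\ne j} e^i_j\otimes e^j_i,\qquad s_{ik}=\begin{cases}\omega,& i<k,\\ q,& i=k,\\ 0,& i>k.\end{cases}$$ An admissible pair $(Y,\sigma)$ consists of a subset $Y\subset I=[1,n]$ (with the induced order) and a (strictly) decreasing injective map $\sigma\colon Y\to I$ without stable points, i.e. $\sigma(i)\ne i$ for all $i\in Y$. Put $Y_+=\{i\in Y: i>\sigma(i)\}$, $Y_-=\{i\in Y: i<\sigma(i)\}$, $b_-=\max(Y_-\cup\sigma(Y_+))$, $b_+=\min(Y_+\cup\sigma(Y_-))$; one has $b_-<b_+$. If $Y=\emptyset$, the convention is $b_-=0$, $b_+=n+1$. *)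

theory Defs
  imports Complex_Main "HOL-Algebra.FiniteProduct" "Jordan_Normal_Form.Matrix"
begin

text \<open>
  \<open>End(C^n)\<close> is the set of complex \<open>n \<times> n\<close> matrices.  Matrix entries are indexed from 0 in the
  library, whereas all index sets below are intervals of the form \<open>[1,n]\<close>; the shift happens
  only in the following definition.
\<close>

definition mat_unit :: "nat \<Rightarrow> nat \<Rightarrow> nat \<Rightarrow> complex mat" where
  "mat_unit n i j = mat n n (\<lambda>(r, c). if Suc r = i \<and> Suc c = j then 1 else 0)"

text \<open>The upper index of the basis element \<open>e^i_j\<close> is the row and the lower one the column.\<close>

lemma mat_unit_carrier [simp]: "mat_unit n i j \<in> carrier_mat n n"
  by (simp add: mat_unit_def)

lemma mat_unit_mult:
  assumes "i \<in> {1..n}" "j \<in> {1..n}" "l \<in> {1..n}" "k \<in> {1..n}"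
  shows "mat_unit n i j * mat_unit n l k = (if l = j then 1 else 0) \<cdot>\<^sub>m mat_unit n i k"
proof (rule eq_matI)
  fix r c assume rc: "r < dim_row ((if l = j then 1 else 0) \<cdot>\<^sub>m mat_unit n i k)"
    "c < dim_col ((if l = j then 1 else 0) \<cdot>\<^sub>m mat_unit n i k)"
  then have r: "r < n" and c: "c < n" by (auto simp: mat_unit_def)
  have "(mat_unit n i j * mat_unit n l k) $$ (r, c) =
      (\<Sum>t\<in>{0..<n}. (if Suc r = i \<and> Suc t = j then 1 else 0) * (if Suc t = l \<and> Suc c = k then 1 else 0))"
    using r c by (simp add: mat_unit_def scalar_prod_def)
  also have "\<dots> = (\<Sum>t\<in>{0..<n}. if t = j - 1 then (if l = j \<and> Suc r = i \<and> Suc c = k then 1 else 0) else 0)"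
    using assms by (intro sum.cong) auto
  also have "\<dots> = (if l = j \<and> Suc r = i \<and> Suc c = k then 1 else 0)"
  proof -
    have "j - 1 < n" using assms by auto
    then show ?thesis by simp
  qed
  finally show "(mat_unit n i j * mat_unit n l k) $$ (r, c) =
      ((if l = j then 1 else 0) \<cdot>\<^sub>m mat_unit n i k) $$ (r, c)"
    using r c by (simp add: mat_unit_def)
qed (auto simp: mat_unit_def)

definition mat_sum :: "nat \<Rightarrow> ('i \<Rightarrow> complex mat) \<Rightarrow> 'i set \<Rightarrow> complex mat" where
  "mat_sum m f I = finsum (module_mat TYPE(complex) m m) f I"

lemma
  assumes "finite I" "\<And>i. i \<in> I \<Longrightarrow> f i \<in> carrier_mat m m"
  shows mat_sum_carrier: "mat_sum m f I \<in> carrier_mat m m"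
    and index_mat_sum: "r < m \<Longrightarrow> c < m \<Longrightarrow> mat_sum m f I $$ (r, c) = (\<Sum>i\<in>I. f i $$ (r, c))"
proof -
  interpret abelian_group "module_mat TYPE(complex) m m" by (rule abelian_group_mat)
  have "mat_sum m f I \<in> carrier_mat m m \<and>
    (r < m \<longrightarrow> c < m \<longrightarrow> mat_sum m f I $$ (r, c) = (\<Sum>i\<in>I. f i $$ (r, c)))"
    using assms
  proof (induction I)
    case empty
    show ?case by (simp add: mat_sum_def module_mat_simps)
  next
    case (insert a I)
    have fa: "f a \<in> carrier_mat m m" and fI: "f \<in> I \<rightarrow> carrier_mat m m" using insert by auto
    have eq: "mat_sum m f (insert a I) = f a + mat_sum m f I"
      unfolding mat_sum_def
      using finsum_insert[of I a f] insert.hyps fa fI by (simp add: module_mat_simps)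
    have IH: "mat_sum m f I \<in> carrier_mat m m"
      "r < m \<longrightarrow> c < m \<longrightarrow> mat_sum m f I $$ (r, c) = (\<Sum>i\<in>I. f i $$ (r, c))"
      using insert by auto
    then show ?case unfolding eq using insert.hyps fa by auto
  qed
  then show "mat_sum m f I \<in> carrier_mat m m"
    and "r < m \<Longrightarrow> c < m \<Longrightarrow> mat_sum m f I $$ (r, c) = (\<Sum>i\<in>I. f i $$ (r, c))" by auto
qed

text \<open>
  The Kronecker product identifies \<open>End(C^n) \<otimes> End(C^n)\<close> with the complex \<open>n^2 \<times> n^2\<close> matrices.
\<close>

definition kron :: "complex mat \<Rightarrow> complex mat \<Rightarrow> complex mat" where
  "kron A B = mat (dim_row A * dim_row B) (dim_col A * dim_col B)
     (\<lambda>(r, c). A $$ (r div dim_row B, c div dim_col B) * B $$ (r mod dim_row B, c mod dim_col B))"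

lemma kron_carrier [simp]:
  "A \<in> carrier_mat n n \<Longrightarrow> B \<in> carrier_mat n n \<Longrightarrow> kron A B \<in> carrier_mat (n * n) (n * n)"
  by (auto simp: kron_def)

definition braid_coeff :: "complex \<Rightarrow> nat \<Rightarrow> nat \<Rightarrow> complex" where
  "braid_coeff q i k = (if i < k then q - inverse q else if i = k then q else 0)"

definition braid_matrix :: "nat \<Rightarrow> complex \<Rightarrow> complex mat" where
  "braid_matrix n q =
     mat_sum (n * n) (\<lambda>(i, k). braid_coeff q i k \<cdot>\<^sub>m kron (mat_unit n i i) (mat_unit n k k))
       ({1..n} \<times> {1..n})
   + mat_sum (n * n) (\<lambda>(i, j). kron (mat_unit n i j) (mat_unit n j i))
       {(i, j) \<in> {1..n} \<times> {1..n}. i \<noteq> j}"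

definition reflection_equation :: "nat \<Rightarrow> complex \<Rightarrow> complex mat \<Rightarrow> bool" where
  "reflection_equation n q A \<longleftrightarrow>
     (let S = braid_matrix n q; A\<^sub>2 = kron (1\<^sub>m n) A in S * A\<^sub>2 * S * A\<^sub>2 = A\<^sub>2 * S * A\<^sub>2 * S)"

text \<open>A map \<open>\<sigma> : Y \<rightarrow> I\<close> is given by a total function whose values off \<open>Y\<close> are irrelevant.\<close>

definition admissible_pair :: "nat \<Rightarrow> nat set \<Rightarrow> (nat \<Rightarrow> nat) \<Rightarrow> bool" where
  "admissible_pair n Y \<sigma> \<longleftrightarrow>
     Y \<subseteq> {1..n} \<and> \<sigma> ` Y \<subseteq> {1..n} \<and> inj_on \<sigma> Y \<and> strict_antimono_on Y \<sigma> \<and> (\<forall>i\<in>Y. \<sigma> i \<noteq> i)"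

definition Y_plus :: "nat set \<Rightarrow> (nat \<Rightarrow> nat) \<Rightarrow> nat set" where
  "Y_plus Y \<sigma> = {i \<in> Y. i > \<sigma> i}"

definition Y_minus :: "nat set \<Rightarrow> (nat \<Rightarrow> nat) \<Rightarrow> nat set" where
  "Y_minus Y \<sigma> = {i \<in> Y. i < \<sigma> i}"

definition b_minus :: "nat set \<Rightarrow> (nat \<Rightarrow> nat) \<Rightarrow> nat" where
  "b_minus Y \<sigma> = (if Y = {} then 0 else Max (Y_minus Y \<sigma> \<union> \<sigma> ` Y_plus Y \<sigma>))"

definition b_plus :: "nat \<Rightarrow> nat set \<Rightarrow> (nat \<Rightarrow> nat) \<Rightarrow> nat" where
  "b_plus n Y \<sigma> = (if Y = {} then n + 1 else Min (Y_plus Y \<sigma> \<union> \<sigma> ` Y_minus Y \<sigma>))"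

lemma b_minus_less_b_plus:
  assumes "admissible_pair n Y \<sigma>"
  shows "b_minus Y \<sigma> < b_plus n Y \<sigma>"
proof (cases "Y = {}")
  case True
  then show ?thesis by (simp add: b_minus_def b_plus_def)
next
  case False
  let ?L = "Y_minus Y \<sigma> \<union> \<sigma> ` Y_plus Y \<sigma>" and ?R = "Y_plus Y \<sigma> \<union> \<sigma> ` Y_minus Y \<sigma>"
  have "finite Y"
    using assms by (auto simp: admissible_pair_def intro: finite_subset)
  then have fin: "finite ?L" "finite ?R"
    by (auto simp: Y_minus_def Y_plus_def)
  have anti: "\<sigma> j < \<sigma> i" if "i \<in> Y" "j \<in> Y" "i < j" for i j
    using assms that by (auto simp: admissible_pair_def monotone_on_def)
  have split: "i \<in> Y_minus Y \<sigma> \<or> i \<in> Y_plus Y \<sigma>" if "i \<in> Y" for i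
    using assms that by (force simp: admissible_pair_def Y_minus_def Y_plus_def)
  have ne: "?L \<noteq> {}" "?R \<noteq> {}"
    using False split by auto
  have lt: "a < b" if "a \<in> ?L" "b \<in> ?R" for a b
  proof -
    have mp: "i < j \<and> \<sigma> j < \<sigma> i" if "i \<in> Y_minus Y \<sigma>" "j \<in> Y_plus Y \<sigma>" for i j
      using that anti[of i j] anti[of j i]
      by (cases i j rule: linorder_cases) (auto simp: Y_minus_def Y_plus_def)
    have mm: "i < \<sigma> j" if "i \<in> Y_minus Y \<sigma>" "j \<in> Y_minus Y \<sigma>" for i j
      using that anti[of j i]
      by (cases i j rule: linorder_cases) (auto simp: Y_minus_def)
    have pp: "\<sigma> i < j" if "i \<in> Y_plus Y \<sigma>" "j \<in> Y_plus Y \<sigma>" for i j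
      using that anti[of j i]
      by (cases i j rule: linorder_cases) (auto simp: Y_plus_def)
    show ?thesis using that mp mm pp by blast
  qed
  show ?thesis
    using False fin ne lt Max_in[of ?L] Min_in[of ?R] by (simp add: b_minus_def b_plus_def)
qed

definition matrix_of_data ::
  "nat \<Rightarrow> nat set \<Rightarrow> (nat \<Rightarrow> nat) \<Rightarrow> (nat \<Rightarrow> complex) \<Rightarrow> (nat \<Rightarrow> complex) \<Rightarrow> complex mat" where
  "matrix_of_data n Y \<sigma> x y =
     mat_sum n (\<lambda>i. x i \<cdot>\<^sub>m mat_unit n i i) {1..n} + mat_sum n (\<lambda>j. y j \<cdot>\<^sub>m mat_unit n (\<sigma> j) j) Y"

definition data_type1 ::
  "nat \<Rightarrow> nat set \<Rightarrow> (nat \<Rightarrow> nat) \<Rightarrow> (nat \<Rightarrow> complex) \<Rightarrow> (nat \<Rightarrow> complex) \<Rightarrow> bool" where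
  "data_type1 n Y \<sigma> x y \<longleftrightarrow>
     admissible_pair n Y \<sigma> \<and>
     (\<exists>bm bp :: nat. 0 < bm \<and> 0 < bp \<and> bm < bp \<and> bm + bp \<le> n + 1 \<and>
        Y = {1..bm} \<union> {bp..bp + bm - 1} \<and> (\<forall>i\<in>Y. \<sigma> i = bp + bm - i) \<and>
        (\<exists>l m :: complex.
           (\<forall>i\<in>{1..bm}. x i = l + m) \<and> (\<forall>i\<in>{bm<..<bp}. x i = l) \<and> (\<forall>i\<in>{bp..n}. x i = 0) \<and>
           (\<forall>i\<in>Y. y i * y (\<sigma> i) = - (l * m) \<and> - (l * m) \<noteq> 0)))"

definition data_type2 ::
  "nat \<Rightarrow> nat set \<Rightarrow> (nat \<Rightarrow> nat) \<Rightarrow> (nat \<Rightarrow> complex) \<Rightarrow> (nat \<Rightarrow> complex) \<Rightarrow> bool" where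
  "data_type2 n Y \<sigma> x y \<longleftrightarrow>
     admissible_pair n Y \<sigma> \<and> Y \<inter> \<sigma> ` Y = {} \<and>
     (\<exists>b\<in>{b_minus Y \<sigma>..<b_plus n Y \<sigma>}. \<exists>l :: complex.
        (\<forall>i\<in>{1..b}. x i = l) \<and> (\<forall>i\<in>{b<..n}. x i = 0)) \<and>
     (\<forall>i\<in>Y. y i \<noteq> 0)"

end

theory Submission
  imports Defs
begin

text \<open>
  Written out in matrix entries, the reflection equation involves only products of two entries and
  the quadratic sums \<open>\<Sum>\<^sub>e s\<^sub>b\<^sub>e a\<^sub>i\<^sub>e a\<^sub>e\<^sub>k\<close>.  Since \<open>q \<noteq> 1\<close>, every row and every column has at most one
  nonzero off-diagonal entry; since \<open>q \<noteq> q\<^sup>-\<^sup>1\<close>, these entries form the graph of a decreasing map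
  \<open>\<sigma> : Y \<rightarrow> I\<close>, in which two consecutive arrows always form a 2-cycle.  What remains are conditions
  on the diagonal: an off-diagonal entry forces \<open>x\<close> to be constant up to its smaller index and zero
  from its larger index on, and for \<open>i < j\<close> the quantity \<open>x\<^sub>j (x\<^sub>i - x\<^sub>j)\<close> is determined by the
  products \<open>y\<^sub>k y\<^bsub>\<sigma>(k)\<^esub>\<close> over 2-cycles.  Without 2-cycles this is Type 2.  Otherwise let \<open>(u, v)\<close>,
  \<open>u < v\<close>, be the innermost 2-cycle: the quadratic relations force every \<open>i < u\<close> into a 2-cycle with
  the same product \<open>p\<close>, make every \<open>x\<^sub>b\<close> with \<open>u < b < v\<close> the same root of \<open>t\<^sup>2 - x\<^sub>u t = p\<close>, and exclude
  gaps in \<open>\<sigma>([1,u])\<close>, which gives Type 1.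
\<close>

section \<open>The reflection equation in matrix entries\<close>

definition entry :: "complex mat \<Rightarrow> nat \<Rightarrow> nat \<Rightarrow> complex" where
  "entry A i k = A $$ (i - 1, k - 1)"

text \<open>The row-major order matches the use of \<open>div\<close> and \<open>mod\<close> in
  \<open>kron\<close>; both arguments are counted from 1, the result from 0.\<close>

definition pair_index :: "nat \<Rightarrow> nat \<Rightarrow> nat \<Rightarrow> nat" where
  "pair_index n i k = (i - 1) * n + (k - 1)"

definition entry2 :: "nat \<Rightarrow> complex mat \<Rightarrow> nat \<Rightarrow> nat \<Rightarrow> nat \<Rightarrow> nat \<Rightarrow> complex" where
  "entry2 n M i k l m = M $$ (pair_index n i k, pair_index n l m)"

lemma pair_index_less:
  assumes "i \<in> {1..n}" "k \<in> {1..n}"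
  shows "pair_index n i k < n * n"
proof -
  have "(i - 1) * n + (k - 1) < (i - 1) * n + n"
    using assms by (intro add_strict_left_mono) auto
  also have "\<dots> = Suc (i - 1) * n" by simp
  also have "\<dots> \<le> n * n"
    using assms by (intro mult_right_mono) auto
  finally show ?thesis by (simp add: pair_index_def)
qed

lemma pair_index_div_mod:
  assumes "i \<in> {1..n}" "k \<in> {1..n}"
  shows "pair_index n i k div n = i - 1" "pair_index n i k mod n = k - 1"
proof -
  have "k - 1 < n" using assms by auto
  then show "pair_index n i k div n = i - 1" "pair_index n i k mod n = k - 1"
    unfolding pair_index_def by simp_all
qed

lemma bij_betw_pair_index:
  "bij_betw (\<lambda>(i, k). pair_index n i k) ({1..n} \<times> {1..n}) {..<n * n}"
proof (rule bij_betw_byWitness[where f' = "\<lambda>t. (Suc (t div n), Suc (t mod n))"])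
  show "\<forall>p\<in>{1..n} \<times> {1..n}. (\<lambda>t. (Suc (t div n), Suc (t mod n))) ((\<lambda>(i, k). pair_index n i k) p) = p"
    by (auto simp: pair_index_div_mod)
  show "\<forall>t\<in>{..<n * n}. (\<lambda>(i, k). pair_index n i k) (Suc (t div n), Suc (t mod n)) = t"
    by (auto simp: pair_index_def)
  show "(\<lambda>(i, k). pair_index n i k) ` ({1..n} \<times> {1..n}) \<subseteq> {..<n * n}"
    using pair_index_less by auto
  show "(\<lambda>t. (Suc (t div n), Suc (t mod n))) ` {..<n * n} \<subseteq> {1..n} \<times> {1..n}"
  proof safe
    fix t :: nat assume t: "t < n * n"
    then have "n > 0" by (cases n) auto
    with t show "Suc (t div n) \<in> {1..n}" "Suc (t mod n) \<in> {1..n}"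
      by (auto simp: Suc_le_eq less_mult_imp_div_less)
  qed
qed

lemma sum_pair_index:
  "(\<Sum>t<n * n. f t) = (\<Sum>i=1..n. \<Sum>k=1..n. f (pair_index n i k))"
proof -
  have "(\<Sum>t<n * n. f t) = (\<Sum>p\<in>{1..n} \<times> {1..n}. f (case p of (i, k) \<Rightarrow> pair_index n i k))"
    using sum.reindex_bij_betw[OF bij_betw_pair_index, of f n] by (simp add: case_prod_unfold)
  also have "\<dots> = (\<Sum>i=1..n. \<Sum>k=1..n. f (pair_index n i k))"
    by (simp add: sum.cartesian_product')
  finally show ?thesis .
qed

lemma pair_index_surj:
  assumes "t < n * n"
  obtains i k where "i \<in> {1..n}" "k \<in> {1..n}" "t = pair_index n i k"
proof -
  have "t \<in> (\<lambda>(i, k). pair_index n i k) ` ({1..n} \<times> {1..n})"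
    using bij_betw_imp_surj_on[OF bij_betw_pair_index, of n] assms by simp
  then show thesis using that by auto
qed

lemma mat_eq_iff_entry2:
  assumes "M \<in> carrier_mat (n * n) (n * n)" "N \<in> carrier_mat (n * n) (n * n)"
  shows "M = N \<longleftrightarrow> (\<forall>i\<in>{1..n}. \<forall>k\<in>{1..n}. \<forall>l\<in>{1..n}. \<forall>m\<in>{1..n}.
           entry2 n M i k l m = entry2 n N i k l m)"
proof
  assume *: "\<forall>i\<in>{1..n}. \<forall>k\<in>{1..n}. \<forall>l\<in>{1..n}. \<forall>m\<in>{1..n}. entry2 n M i k l m = entry2 n N i k l m"
  show "M = N"
  proof (rule eq_matI)
    fix r c assume rc: "r < dim_row N" "c < dim_col N"
    then have "r < n * n" "c < n * n" using assms by auto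
    then show "M $$ (r, c) = N $$ (r, c)"
      using * by (elim pair_index_surj) (auto simp: entry2_def)
  qed (use assms in auto)
qed auto

lemma entry2_mult:
  assumes "M \<in> carrier_mat (n * n) (n * n)" "N \<in> carrier_mat (n * n) (n * n)"
    and "i \<in> {1..n}" "k \<in> {1..n}" "l \<in> {1..n}" "m \<in> {1..n}"
  shows "entry2 n (M * N) i k l m = (\<Sum>e=1..n. \<Sum>f=1..n. entry2 n M i k e f * entry2 n N e f l m)"
proof -
  have "entry2 n (M * N) i k l m =
      (\<Sum>t<n * n. M $$ (pair_index n i k, t) * N $$ (t, pair_index n l m))"
    using assms pair_index_less
    by (auto simp: entry2_def scalar_prod_def lessThan_atLeast0)
  then show ?thesis
    unfolding sum_pair_index by (simp add: entry2_def)
qed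

lemma entry2_kron:
  assumes "A \<in> carrier_mat n n" "B \<in> carrier_mat n n"
    and "i \<in> {1..n}" "k \<in> {1..n}" "l \<in> {1..n}" "m \<in> {1..n}"
  shows "entry2 n (kron A B) i k l m = entry A i l * entry B k m"
  using assms pair_index_less
  by (auto simp: entry2_def entry_def kron_def pair_index_div_mod)

lemma entry_mat_unit:
  assumes "r \<in> {1..n}" "c \<in> {1..n}"
  shows "entry (mat_unit n i j) r c = (if r = i \<and> c = j then 1 else 0)"
  using assms by (auto simp: entry_def mat_unit_def)

section \<open>Entries of S and of both sides of the reflection equation\<close>

lemma entry2_braid_matrix:
  assumes i: "i \<in> {1..n}" and k: "k \<in> {1..n}" and l: "l \<in> {1..n}" and m: "m \<in> {1..n}"
  shows "entry2 n (braid_matrix n q) i k l m =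
    (if i = l \<and> k = m then braid_coeff q i k else 0) + (if i \<noteq> k \<and> i = m \<and> k = l then 1 else 0)"
proof -
  let ?D = "\<lambda>(i, k). braid_coeff q i k \<cdot>\<^sub>m kron (mat_unit n i i) (mat_unit n k k)"
  let ?P = "\<lambda>(i, j). kron (mat_unit n i j) (mat_unit n j i)"
  let ?J = "{(i, j) \<in> {1..n} \<times> {1..n}. i \<noteq> j}"
  have finJ: "finite ?J" by (rule finite_subset[of _ "{1..n} \<times> {1..n}"]) auto
  have D: "?D p \<in> carrier_mat (n * n) (n * n)" and P: "?P p \<in> carrier_mat (n * n) (n * n)" for p
    by (auto simp: case_prod_unfold)
  have lt: "pair_index n i k < n * n" "pair_index n l m < n * n"
    using assms pair_index_less by auto
  \<comment> \<open>Row \<open>(i, k)\<close> picks out a single summand of the diagonal part,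
    namely \<open>p = (i, k)\<close>.\<close>
  have eD: "?D p $$ (pair_index n i k, pair_index n l m) =
      (if p = (i, k) then (if i = l \<and> k = m then braid_coeff q i k else 0) else 0)" for p
  proof -
    have "?D p $$ (pair_index n i k, pair_index n l m) = braid_coeff q (fst p) (snd p) *
        entry2 n (kron (mat_unit n (fst p) (fst p)) (mat_unit n (snd p) (snd p))) i k l m"
      using lt by (simp add: case_prod_unfold entry2_def kron_def mat_unit_def)
    also have "\<dots> = (if p = (i, k) then (if i = l \<and> k = m then braid_coeff q i k else 0) else 0)"
      using assms by (cases p) (auto simp: entry2_kron entry_mat_unit)
    finally show ?thesis .
  qed
  \<comment> \<open>In the flip part the only summand that can meet this entry is
    \<open>p = (i, l)\<close>.\<close>
  have eP: "?P p $$ (pair_index n i k, pair_index n l m) =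
      (if p = (i, l) then (if k = l \<and> m = i then 1 else 0) else 0)" for p
  proof -
    have "?P p $$ (pair_index n i k, pair_index n l m) =
        entry2 n (kron (mat_unit n (fst p) (snd p)) (mat_unit n (snd p) (fst p))) i k l m"
      by (simp add: case_prod_unfold entry2_def)
    also have "\<dots> = (if p = (i, l) then (if k = l \<and> m = i then 1 else 0) else 0)"
      using assms by (cases p) (auto simp: entry2_kron entry_mat_unit)
    finally show ?thesis .
  qed
  have "entry2 n (braid_matrix n q) i k l m =
      (\<Sum>p\<in>{1..n} \<times> {1..n}. ?D p $$ (pair_index n i k, pair_index n l m)) +
      (\<Sum>p\<in>?J. ?P p $$ (pair_index n i k, pair_index n l m))"
    unfolding entry2_def braid_matrix_def
    using mat_sum_carrier[of ?J ?P "n * n"] finJ D P lt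
      index_mat_sum[of "{1..n} \<times> {1..n}" ?D "n * n"] index_mat_sum[of ?J ?P "n * n"]
    by (subst index_add_mat) auto
  also have "\<dots> = (if i = l \<and> k = m then braid_coeff q i k else 0) +
      (if i \<noteq> k \<and> i = m \<and> k = l then 1 else 0)"
    unfolding eD eP using finJ assms by auto
  finally show ?thesis .
qed

lemma entry_one: "i \<in> {1..n} \<Longrightarrow> k \<in> {1..n} \<Longrightarrow> entry (1\<^sub>m n) i k = (if i = k then 1 else 0)"
  by (auto simp: entry_def)

lemma braid_matrix_carrier: "braid_matrix n q \<in> carrier_mat (n * n) (n * n)"
proof -
  have "finite {(i, j) \<in> {1..n} \<times> {1..n}. i \<noteq> j}"
    by (rule finite_subset[of _ "{1..n} \<times> {1..n}"]) auto
  then show ?thesis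
    unfolding braid_matrix_def by (intro add_carrier_mat mat_sum_carrier) auto
qed

text \<open>This is the entry \<open>(i, k)\<close> of A D A, where D is the diagonal matrix built
  from row \<open>b\<close> of the coefficients of S.\<close>

definition weighted_square ::
  "nat \<Rightarrow> complex \<Rightarrow> (nat \<Rightarrow> nat \<Rightarrow> complex) \<Rightarrow> nat \<Rightarrow> nat \<Rightarrow> nat \<Rightarrow> complex" where
  "weighted_square n q a b i k = (\<Sum>e=1..n. braid_coeff q b e * a i e * a e k)"

definition reflection_entries ::
  "nat \<Rightarrow> complex \<Rightarrow> (nat \<Rightarrow> nat \<Rightarrow> complex) \<Rightarrow> bool" where
  "reflection_entries n q a \<longleftrightarrow>
    (\<forall>i\<in>{1..n}. \<forall>k\<in>{1..n}. \<forall>l\<in>{1..n}. \<forall>m\<in>{1..n}.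
       braid_coeff q i k *
         (if i = l then weighted_square n q a i k m else a k l * a i m) +
       (if i = k then 0 else if k = l then weighted_square n q a k i m else a i l * a k m) =
       braid_coeff q l m *
         (if i = l then weighted_square n q a i k m else a k l * a i m) +
       (if l = m then 0 else if i = m then weighted_square n q a i k l else a i l * a k m))"

lemma sum_delta2:
  fixes c :: complex and i j n :: nat
  assumes "i \<in> {1..n}" "j \<in> {1..n}"
  shows "(\<Sum>e=1..n. \<Sum>f=1..n. if e = i \<and> f = j then c else 0) = c"
proof -
  have "(\<Sum>e=1..n. \<Sum>f=1..n. if e = i \<and> f = j then c else 0) = (\<Sum>e=1..n. if e = i then c else 0)"
    using assms(2) by (intro sum.cong[OF refl]) simp
  then show ?thesis using assms(1) by simp
qed

text \<open>The factor 1 tensor A leaves the first index alone, so one term comes from the diagonal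
  part of S and one from its flip part.\<close>

lemma entry2_braid_kron:
  assumes A: "A \<in> carrier_mat n n"
    and I: "i \<in> {1..n}" "k \<in> {1..n}" "l \<in> {1..n}" "m \<in> {1..n}"
  shows "entry2 n (braid_matrix n q * kron (1\<^sub>m n) A) i k l m =
      (if i = l then braid_coeff q i k * entry A k m else 0) +
      (if i \<noteq> k \<and> k = l then entry A i m else 0)" (is ?L)
    and "entry2 n (kron (1\<^sub>m n) A * braid_matrix n q) i k l m =
      (if i = l then braid_coeff q i m * entry A k m else 0) +
      (if l \<noteq> m \<and> i = m then entry A k l else 0)" (is ?R)
proof -
  have K: "kron (1\<^sub>m n) A \<in> carrier_mat (n * n) (n * n)" using A by simp
  note S = braid_matrix_carrier[of n q]
  have "entry2 n (braid_matrix n q * kron (1\<^sub>m n) A) i k l m =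
      (\<Sum>e=1..n. \<Sum>f=1..n. ((if i = e \<and> k = f then braid_coeff q i k else 0) +
         (if i \<noteq> k \<and> i = f \<and> k = e then 1 else 0)) * ((if e = l then 1 else 0) * entry A f m))"
    unfolding entry2_mult[OF S K I]
    by (intro sum.cong refl) (use A I in \<open>simp only: entry2_braid_matrix entry2_kron[OF one_carrier_mat A] entry_one\<close>)
  also have "\<dots> = (\<Sum>e=1..n. \<Sum>f=1..n.
      (if e = l \<and> f = k then (if i = l then braid_coeff q i k * entry A k m else 0) else 0) +
      (if e = l \<and> f = i then (if i \<noteq> k \<and> k = l then entry A i m else 0) else 0))"
    by (intro sum.cong refl) simp
  finally show ?L
    unfolding sum.distrib sum_delta2[OF I(3,2)] sum_delta2[OF I(3,1)] .
  have "entry2 n (kron (1\<^sub>m n) A * braid_matrix n q) i k l m =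
      (\<Sum>e=1..n. \<Sum>f=1..n. ((if i = e then 1 else 0) * entry A k f) * ((if e = l \<and> f = m then braid_coeff q e f else 0) +
         (if e \<noteq> f \<and> e = m \<and> f = l then 1 else 0)))"
    unfolding entry2_mult[OF K S I]
    by (intro sum.cong refl) (use A I in \<open>simp only: entry2_braid_matrix entry2_kron[OF one_carrier_mat A] entry_one\<close>)
  also have "\<dots> = (\<Sum>e=1..n. \<Sum>f=1..n.
      (if e = i \<and> f = m then (if i = l then braid_coeff q i m * entry A k m else 0) else 0) +
      (if e = i \<and> f = l then (if l \<noteq> m \<and> i = m then entry A k l else 0) else 0))"
    by (intro sum.cong refl) simp
  finally show ?R
    unfolding sum.distrib sum_delta2[OF I(1,4)] sum_delta2[OF I(1,3)] .
qed

lemma sum_delta_pair: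
  fixes F G :: "nat \<Rightarrow> nat \<Rightarrow> complex"
  assumes "i \<in> {1..n}" "j \<in> {1..n}"
  shows "(\<Sum>e=1..n. \<Sum>f=1..n. (if i = e then F e f else 0) + (if j = e then G e f else 0)) =
    (\<Sum>f=1..n. F i f) + (\<Sum>f=1..n. G j f)"
proof -
  have "(\<Sum>e=1..n. \<Sum>f=1..n. (if i = e then F e f else 0) + (if j = e then G e f else 0)) =
      (\<Sum>e=1..n. (if i = e then (\<Sum>f=1..n. F e f) else 0) + (if j = e then (\<Sum>f=1..n. G e f) else 0))"
    by (intro sum.cong refl) (auto simp: sum.distrib)
  then show ?thesis using assms by (simp add: sum.distrib)
qed

text \<open>By associativity the equation reads (SK)(SK) = (KS)(KS) with K = 1 tensor A. A genuine
  sum survives only where the outer indices coincide, and it is then a weighted square; otherwise a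
  single product of two entries remains.\<close>

lemma reflection_equation_iff_entries:
  assumes A: "A \<in> carrier_mat n n"
  shows "reflection_equation n q A \<longleftrightarrow> reflection_entries n q (entry A)"
proof -
  define S where "S = braid_matrix n q"
  define K where "K = kron (1\<^sub>m n) A"
  have S: "S \<in> carrier_mat (n * n) (n * n)" and K: "K \<in> carrier_mat (n * n) (n * n)"
    using A by (simp_all add: S_def K_def braid_matrix_carrier)
  then have SK: "S * K \<in> carrier_mat (n * n) (n * n)" and KS: "K * S \<in> carrier_mat (n * n) (n * n)"
    by auto
  note E = entry2_braid_kron[OF A, of _ _ _ _ q, folded S_def K_def]
  let ?a = "entry A" and ?s = "braid_coeff q" and ?W = "weighted_square n q (entry A)"
  have L: "entry2 n (S * K * (S * K)) i k l m =
      ?s i k * (if i = l then ?W i k m else ?a k l * ?a i m) +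
      (if i = k then 0 else if k = l then ?W k i m else ?a i l * ?a k m)"
    if I: "i \<in> {1..n}" "k \<in> {1..n}" "l \<in> {1..n}" "m \<in> {1..n}" for i k l m
  proof -
    \<comment> \<open>For \<open>e = l\<close> the diagonal part of S contributes for every
      \<open>f\<close>; for \<open>e \<noteq> l\<close> only the flip term with \<open>f = l\<close>
      is left.\<close>
    have inner: "(\<Sum>f=1..n. ?a j f * ((if e = l then ?s e f * ?a f m else 0) +
        (if e \<noteq> f \<and> f = l then ?a e m else 0))) = (if e = l then ?W e j m else ?a j l * ?a e m)"
      for e j
    proof (cases "e = l")
      case True
      have "(\<Sum>f=1..n. ?a j f * ((if e = l then ?s e f * ?a f m else 0) +
          (if e \<noteq> f \<and> f = l then ?a e m else 0))) = ?W e j m"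
        unfolding weighted_square_def using True by (intro sum.cong refl) auto
      with True show ?thesis by simp
    next
      case False
      have "(\<Sum>f=1..n. ?a j f * ((if e = l then ?s e f * ?a f m else 0) +
          (if e \<noteq> f \<and> f = l then ?a e m else 0))) = (\<Sum>f=1..n. if f = l then ?a j f * ?a e m else 0)"
        using False by (intro sum.cong refl) auto
      with False I show ?thesis by simp
    qed
    have "entry2 n (S * K * (S * K)) i k l m = (\<Sum>e=1..n. \<Sum>f=1..n.
        (if i = e then ?s i k * (?a k f * ((if e = l then ?s e f * ?a f m else 0) +
           (if e \<noteq> f \<and> f = l then ?a e m else 0))) else 0) +
        (if k = e then (if i \<noteq> k then 1 else 0) * (?a i f * ((if e = l then ?s e f * ?a f m else 0) +
           (if e \<noteq> f \<and> f = l then ?a e m else 0))) else 0))"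
      unfolding entry2_mult[OF SK SK I]
      by (intro sum.cong refl)
        (use I in \<open>simp only: E(1), auto simp: algebra_simps\<close>)
    also have "\<dots> = ?s i k * (if i = l then ?W i k m else ?a k l * ?a i m) +
        (if i \<noteq> k then 1 else 0) * (if k = l then ?W k i m else ?a i l * ?a k m)"
      unfolding sum_delta_pair[OF I(1,2)] sum_distrib_left[symmetric] inner ..
    finally show ?thesis by auto
  qed
  have R: "entry2 n (K * S * (K * S)) i k l m =
      ?s l m * (if i = l then ?W i k m else ?a k l * ?a i m) +
      (if l = m then 0 else if i = m then ?W i k l else ?a i l * ?a k m)"
    if I: "i \<in> {1..n}" "k \<in> {1..n}" "l \<in> {1..n}" "m \<in> {1..n}" for i k l m
  proof -
    \<comment> \<open>The two summands of the right factor have the same shape, so the sum is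
      computed once with a free index \<open>c\<close> and applied with \<open>c = l\<close> and
      \<open>c = m\<close>.\<close>
    have inner: "(\<Sum>e=1..n. \<Sum>f=1..n. ((if i = e then ?s i f * ?a k f else 0) +
        (if e \<noteq> f \<and> i = f then ?a k e else 0)) * (if e = c then ?a f d else 0)) =
        (if i = c then ?W i k d else ?a k c * ?a i d)" if c: "c \<in> {1..n}" for c d
    proof -
      have "(\<Sum>e=1..n. \<Sum>f=1..n. ((if i = e then ?s i f * ?a k f else 0) +
          (if e \<noteq> f \<and> i = f then ?a k e else 0)) * (if e = c then ?a f d else 0)) =
          (\<Sum>e=1..n. if e = c then (\<Sum>f=1..n. ((if i = e then ?s i f * ?a k f else 0) +
          (if e \<noteq> f \<and> i = f then ?a k e else 0)) * ?a f d) else 0)"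
        by (intro sum.cong refl) auto
      also have "\<dots> = (\<Sum>f=1..n. ((if i = c then ?s i f * ?a k f else 0) +
          (if c \<noteq> f \<and> i = f then ?a k c else 0)) * ?a f d)"
        using c by simp
      also have "\<dots> = (if i = c then ?W i k d else ?a k c * ?a i d)"
      proof (cases "i = c")
        case True
        have "(\<Sum>f=1..n. ((if i = c then ?s i f * ?a k f else 0) +
            (if c \<noteq> f \<and> i = f then ?a k c else 0)) * ?a f d) = ?W i k d"
          unfolding weighted_square_def using True by (intro sum.cong refl) auto
        with True show ?thesis by simp
      next
        case False
        have "(\<Sum>f=1..n. ((if i = c then ?s i f * ?a k f else 0) +
            (if c \<noteq> f \<and> i = f then ?a k c else 0)) * ?a f d) = (\<Sum>f=1..n. if i = f then ?a k c * ?a f d else 0)"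
          using False by (intro sum.cong refl) auto
        with False I show ?thesis by simp
      qed
      finally show ?thesis .
    qed
    have "entry2 n (K * S * (K * S)) i k l m = (\<Sum>e=1..n. \<Sum>f=1..n.
        ((if i = e then ?s i f * ?a k f else 0) + (if e \<noteq> f \<and> i = f then ?a k e else 0)) *
        ((if e = l then ?s e m * ?a f m else 0) + (if l \<noteq> m \<and> e = m then ?a f l else 0)))"
      unfolding entry2_mult[OF KS KS I]
      by (intro sum.cong refl) (use I in \<open>simp only: E(2)\<close>)
    also have "\<dots> = (\<Sum>e=1..n. \<Sum>f=1..n.
        ?s l m * (((if i = e then ?s i f * ?a k f else 0) + (if e \<noteq> f \<and> i = f then ?a k e else 0)) *
          (if e = l then ?a f m else 0)) +
        (if l = m then 0 else 1) * (((if i = e then ?s i f * ?a k f else 0) + (if e \<noteq> f \<and> i = f then ?a k e else 0)) *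
          (if e = m then ?a f l else 0)))"
      by (intro sum.cong refl) (simp add: distrib_left mult_ac)
    also have "\<dots> = ?s l m * (if i = l then ?W i k m else ?a k l * ?a i m) +
        (if l = m then 0 else 1) * (if i = m then ?W i k l else ?a k m * ?a i l)"
      unfolding sum.distrib sum_distrib_left[symmetric] inner[OF I(3)] inner[OF I(4)] ..
    finally show ?thesis by (auto simp: mult.commute)
  qed
  have "reflection_equation n q A \<longleftrightarrow> S * K * (S * K) = K * S * (K * S)"
    using assoc_mult_mat[OF SK S K] assoc_mult_mat[OF KS K S]
    by (simp add: reflection_equation_def Let_def S_def K_def)
  also have "\<dots> \<longleftrightarrow> reflection_entries n q (entry A)"
    unfolding mat_eq_iff_entry2[OF mult_carrier_mat[OF SK SK] mult_carrier_mat[OF KS KS]]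
      reflection_entries_def
    by (intro ball_cong refl) (simp only: L R)
  finally show ?thesis .
qed

section \<open>The shape of a solution\<close>

definition tail_product :: "nat \<Rightarrow> (nat \<Rightarrow> nat \<Rightarrow> complex) \<Rightarrow> nat \<Rightarrow> nat \<Rightarrow> nat \<Rightarrow> complex" where
  "tail_product n a b i k = (\<Sum>e\<in>{b<..n}. a i e * a e k)"

text \<open>The coefficient \<open>braid_coeff q b e\<close> is 0 for \<open>e < b\<close>, q for
  \<open>e = b\<close> and constantly \<omega> for \<open>e > b\<close>, so the sum splits at
  \<open>b\<close>.\<close>

lemma weighted_square_eq:
  assumes "b \<in> {1..n}"
  shows "weighted_square n q a b i k = q * a i b * a b k + (q - inverse q) * tail_product n a b i k"
proof -
  have split: "{1..n} = {1..<b} \<union> ({b} \<union> {b<..n})" using assms by auto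
  have "weighted_square n q a b i k = (\<Sum>e\<in>{1..<b}. braid_coeff q b e * a i e * a e k) +
      (\<Sum>e\<in>{b} \<union> {b<..n}. braid_coeff q b e * a i e * a e k)"
    unfolding weighted_square_def split by (rule sum.union_disjoint) auto
  also have "(\<Sum>e\<in>{1..<b}. braid_coeff q b e * a i e * a e k) = 0"
    by (intro sum.neutral) (auto simp: braid_coeff_def)
  also have "(\<Sum>e\<in>{b} \<union> {b<..n}. braid_coeff q b e * a i e * a e k) =
      q * a i b * a b k + (\<Sum>e\<in>{b<..n}. braid_coeff q b e * a i e * a e k)"
    by (simp add: braid_coeff_def)
  also have "(\<Sum>e\<in>{b<..n}. braid_coeff q b e * a i e * a e k) = (q - inverse q) * tail_product n a b i k"
    unfolding tail_product_def sum_distrib_left by (intro sum.cong refl) (auto simp: braid_coeff_def)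
  finally show ?thesis by simp
qed

lemma sum_two_terms:
  fixes F :: "nat \<Rightarrow> complex"
  assumes "i \<noteq> k" "i \<le> n" "k \<le> n"
    and "\<And>e. e \<in> {b<..n} \<Longrightarrow> e \<noteq> i \<Longrightarrow> e \<noteq> k \<Longrightarrow> F e = 0"
  shows "(\<Sum>e\<in>{b<..n}. F e) = (if b < i then F i else 0) + (if b < k then F k else 0)"
proof -
  have "(\<Sum>e\<in>{b<..n}. F e) = (\<Sum>e\<in>{b<..n}. (if e = i then F i else 0) + (if e = k then F k else 0))"
    using assms by (intro sum.cong) auto
  then show ?thesis using assms by (simp add: sum.distrib)
qed

text \<open>No condition mentions q. The first four describe the off-diagonal support: the graph of
  a decreasing partial injection in which two arrows compose only around a 2-cycle. The other three
  restrict the diagonal.\<close>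

locale reflection_pattern =
  fixes n :: nat and a :: "nat \<Rightarrow> nat \<Rightarrow> complex"
  assumes row: "\<lbrakk>i \<in> {1..n}; k \<in> {1..n}; l \<in> {1..n}; i \<noteq> k; i \<noteq> l; k \<noteq> l\<rbrakk> \<Longrightarrow> a i k * a i l = 0"
    and col: "\<lbrakk>i \<in> {1..n}; k \<in> {1..n}; l \<in> {1..n}; i \<noteq> k; i \<noteq> l; k \<noteq> l\<rbrakk> \<Longrightarrow> a i l * a k l = 0"
    and path: "\<lbrakk>i \<in> {1..n}; k \<in> {1..n}; l \<in> {1..n}; i \<noteq> k; i \<noteq> l; k \<noteq> l\<rbrakk> \<Longrightarrow> a i k * a k l = 0"
    and antitone: "\<lbrakk>i \<in> {1..n}; j \<in> {1..n}; k \<in> {1..n}; l \<in> {1..n}; i < j; k < l; i \<noteq> k; j \<noteq> l\<rbrakk>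
      \<Longrightarrow> a i k * a j l = 0"
    and diag_upper: "\<lbrakk>i \<in> {1..n}; k \<in> {1..n}; i \<noteq> k; a i k \<noteq> 0; max i k \<le> b; b \<le> n\<rbrakk> \<Longrightarrow> a b b = 0"
    and diag_lower: "\<lbrakk>i \<in> {1..n}; k \<in> {1..n}; i \<noteq> k; a i k \<noteq> 0; 1 \<le> b; b \<le> min i k\<rbrakk>
      \<Longrightarrow> a b b = a (min i k) (min i k)"
    and quadratic: "\<lbrakk>i \<in> {1..n}; j \<in> {1..n}; i < j\<rbrakk>
      \<Longrightarrow> tail_product n a j i i - tail_product n a i j j + a i i * a j j = 0"

text \<open>Paths through a third index contribute nothing, so only \<open>e = i\<close> and
  \<open>e = k\<close> remain.\<close>

lemma tail_product_off_diagonal: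
  assumes path: "\<And>e. e \<in> {1..n} \<Longrightarrow> e \<noteq> i \<Longrightarrow> e \<noteq> k \<Longrightarrow> a i e * a e k = 0"
    and "i \<in> {1..n}" "k \<in> {1..n}" "i \<noteq> k"
  shows "tail_product n a b i k = a i k * ((if b < i then a i i else 0) + (if b < k then a k k else 0))"
  unfolding tail_product_def
  by (subst sum_two_terms[of i k]) (use assms in \<open>auto simp: algebra_simps\<close>)

text \<open>Each condition comes from the entry equation at a suitable quadruple of indices, after
  cancelling a nonzero factor such as q - 1, inverse q - 1, \<omega> or q^2 - 1.\<close>

lemma reflection_pattern_if_entries:
  assumes q: "q \<noteq> 0" "q ^ 2 \<noteq> 1" and RE: "reflection_entries n q a"
  shows "reflection_pattern n a"
proof -
  define w where "w = q - inverse q"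
  let ?I = "{1..n}"
  let ?s = "braid_coeff q" and ?W = "weighted_square n q a" and ?G = "tail_product n a"
  have w: "w \<noteq> 0" using q by (auto simp: w_def field_simps power2_eq_square)
  have q1: "q \<noteq> 1" using q by auto
  have qw: "q - w = inverse q" "inverse q \<noteq> 1" using q1 by (auto simp: w_def)
  have s: "?s i k = (if i < k then w else if i = k then q else 0)" for i k
    by (simp add: braid_coeff_def w_def)
  have W: "?W b i k = q * a i b * a b k + w * ?G b i k" if "b \<in> ?I" for b i k
    using weighted_square_eq[OF that] by (simp add: w_def)
  have E: "?s i k * (if i = l then ?W i k m else a k l * a i m) +
       (if i = k then 0 else if k = l then ?W k i m else a i l * a k m) =
       ?s l m * (if i = l then ?W i k m else a k l * a i m) +
       (if l = m then 0 else if i = m then ?W i k l else a i l * a k m)"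
    if "i \<in> ?I" "k \<in> ?I" "l \<in> ?I" "m \<in> ?I" for i k l m
    using RE that unfolding reflection_entries_def by blast
  \<comment> \<open>For \<open>l \<noteq> m\<close> the difference \<open>q - ?s l m\<close> is q or
    its inverse, and neither equals 1.\<close>
  have row: "a i l * a i m = 0"
    if I: "i \<in> ?I" "l \<in> ?I" "m \<in> ?I" and d: "i \<noteq> l" "i \<noteq> m" "l \<noteq> m" for i l m
  proof -
    have "(q - ?s l m - 1) * (a i l * a i m) = 0"
      using E[of i i l m] I d by (simp add: s[of i i] algebra_simps)
    moreover have "q - ?s l m - 1 \<noteq> 0" using qw q1 d by (auto simp: s)
    ultimately show ?thesis by simp
  qed
  have col: "a i l * a k l = 0"
    if I: "i \<in> ?I" "k \<in> ?I" "l \<in> ?I" and d: "i \<noteq> k" "i \<noteq> l" "k \<noteq> l" for i k l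
  proof -
    have "(q - ?s i k - 1) * (a i l * a k l) = 0"
      using E[of i k l l] I d by (simp add: s[of l l] algebra_simps)
    moreover have "q - ?s i k - 1 \<noteq> 0" using qw q1 d by (auto simp: s)
    ultimately show ?thesis by simp
  qed
  have W0: "?W k i m = 0" if I: "i \<in> ?I" "k \<in> ?I" "m \<in> ?I" and "i < k \<and> k < m \<or> m < k \<and> k < i" for i k m
    using E[of k i k m] I that(4) w by (auto simp: s)
  have E5: "?s i k * (a k k * a i m) + ?W k i m = ?s k m * (a k k * a i m) + a i k * a k m"
    if I: "i \<in> ?I" "k \<in> ?I" "m \<in> ?I" and d: "i \<noteq> k" "i \<noteq> m" "k \<noteq> m" for i k m
    using E[of i k k m] I d by simp
  \<comment> \<open>If the product were nonzero, \<open>row\<close> would make \<open>k\<close> the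
    only off-diagonal position in row \<open>i\<close>. The tail product then vanishes, and the
    weighted square is q times the product while the equation demands 1 times it.\<close>
  have path: "a i k * a k m = 0"
    if I: "i \<in> ?I" "k \<in> ?I" "m \<in> ?I" and d: "i \<noteq> k" "i \<noteq> m" "k \<noteq> m" for i k m
  proof (rule ccontr)
    assume nz: "a i k * a k m \<noteq> 0"
    have r: "a i e = 0" if "e \<in> ?I" "e \<noteq> i" "e \<noteq> k" for e
      using row[of i k e] I d that nz by auto
    have "?G k i m = 0"
      unfolding tail_product_def
    proof (intro sum.neutral ballI)
      fix e assume "e \<in> {k<..n}"
      then show "a i e * a e m = 0" using r[of e] r[of m] I d by (cases "e = i") auto
    qed
    then have "(q - 1) * (a i k * a k m) = 0"
      using E5[OF I d] W[OF I(2)] r[of m] I d by (simp add: algebra_simps)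
    with q1 nz show False by simp
  qed
  have G: "?G b i k = a i k * ((if b < i then a i i else 0) + (if b < k then a k k else 0))"
    if "i \<in> ?I" "k \<in> ?I" "i \<noteq> k" for b i k
    by (rule tail_product_off_diagonal) (use path that in auto)
  \<comment> \<open>The equation at \<open>(i, i, i, k)\<close> evaluates the same weighted square
    twice. For \<open>i < k\<close> the comparison isolates the tail term
    \<open>a i k * a k k\<close>, for \<open>i > k\<close> the term
    \<open>a i i * a i k\<close>.\<close>
  have max0: "a (max i k) (max i k) = 0" if I: "i \<in> ?I" "k \<in> ?I" "i \<noteq> k" "a i k \<noteq> 0" for i k
  proof (cases "i < k")
    case True
    have "(q - w) * ?W i i k = a i i * a i k"
      using E[of i i i k] I True by (simp add: s algebra_simps)
    then have "?W i i k = q * (a i i * a i k)" using q qw by (simp add: field_simps)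
    then have "w * (a i k * a k k) = 0"
      using q W[of i i k] G[of i k i] I True by (simp add: algebra_simps)
    then show ?thesis using w I True by simp
  next
    case False
    have "q * ?W i i k = a i i * a i k"
      using E[of i i i k] I False by (simp add: s)
    then have "(q ^ 2 - 1) * (a i i * a i k) = 0"
      using W[of i i k] G[of i k i] I False by (simp add: algebra_simps power2_eq_square)
    then show ?thesis using q I False by (simp add: max_def)
  qed
  \<comment> \<open>Since \<open>path\<close> removes \<open>a i k * a k m\<close>, every remaining
    term of \<open>E5\<close> carries the factor \<open>a i m\<close>, which can be
    cancelled.\<close>
  have E5': "(?s i k - ?s k m) * a k k = - w * ((if k < i then a i i else 0) + (if k < m then a m m else 0))"
    if I: "i \<in> ?I" "k \<in> ?I" "m \<in> ?I" and d: "i \<noteq> k" "i \<noteq> m" "k \<noteq> m" "a i m \<noteq> 0" for i k m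
  proof -
    have "a i m * ((?s i k - ?s k m) * a k k + w * ((if k < i then a i i else 0) + (if k < m then a m m else 0))) = 0"
      using E5[OF I d(1-3)] W[OF I(2), of i m] G[OF I(1,3) d(2), of k] path[OF I d(1-3)]
      by (simp add: algebra_simps)
    with d show ?thesis by (simp add: eq_neg_iff_add_eq_0)
  qed
  show ?thesis
  proof
    fix i j k l assume I: "i \<in> ?I" "j \<in> ?I" "k \<in> ?I" "l \<in> ?I" and d: "i < j" "k < l" "i \<noteq> k" "j \<noteq> l"
    show "a i k * a j l = 0"
    \<comment> \<open>For \<open>i = l\<close> the entry equation has a weighted square in place of
      this product, but then the two entries form a path from \<open>j\<close> over \<open>i\<close>
      to \<open>k\<close>.\<close>
    proof (cases "i = l")
      case True
      then show ?thesis using path[of j i k] I d by (simp add: mult.commute)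
    next
      case False
      then show ?thesis using E[of i j l k] I d w by (simp add: s mult.commute)
    qed
  next
    fix i k b assume I: "i \<in> ?I" "k \<in> ?I" "i \<noteq> k" "a i k \<noteq> 0" and b: "max i k \<le> b" "b \<le> n"
    show "a b b = 0"
    proof (cases "max i k = b")
      case True
      then show ?thesis using max0 I by auto
    next
      case False
      then have "?s i b - ?s b k = w" "b \<in> ?I" "\<not> b < i" "\<not> b < k" "i \<noteq> b" "b \<noteq> k"
        using b I by (auto simp: s)
      then show ?thesis using E5'[of i b k] I w by simp
    qed
  next
    fix i k b assume I: "i \<in> ?I" "k \<in> ?I" "i \<noteq> k" "a i k \<noteq> 0" and b: "1 \<le> b" "b \<le> min i k"
    show "a b b = a (min i k) (min i k)"
    proof (cases "b = min i k")
      case False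
      then have "?s i b - ?s b k = - w" "b \<in> ?I" "b < i" "b < k" "i \<noteq> b" "b \<noteq> k"
        using b I by (auto simp: s)
      then have "- w * a b b = - w * (a i i + a k k)" using E5'[of i b k] I by simp
      then have "a b b = a i i + a k k" using w by simp
      \<comment> \<open>Of the two summands, the one at the larger index is zero.\<close>
      then show ?thesis using max0[OF I] by (auto simp: max_def min_def split: if_splits)
    qed simp
  next
    fix i j assume I: "i \<in> ?I" "j \<in> ?I" and "i < j"
    \<comment> \<open>In the equation at \<open>(i, j, j, i)\<close> the terms
      \<open>q * a i j * a j i\<close> of the two weighted squares cancel, and \<omega> factors out
      of the rest.\<close>
    then have "w * (?G j i i - ?G i j j + a i i * a j j) = 0"
      using E[of i j j i] W by (simp add: s algebra_simps)
    then show "?G j i i - ?G i j j + a i i * a j j = 0" using w by simp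
  qed (use row col path in auto)
qed

text \<open>The pattern determines all off-diagonal weighted squares explicitly; the entry equations
  then follow by going through the coincidences among the four indices.\<close>

lemma (in reflection_pattern) entries:
  assumes q: "q \<noteq> 0"
  shows "reflection_entries n q a"
proof -
  define w where "w = q - inverse q"
  let ?I = "{1..n}"
  let ?s = "braid_coeff q" and ?W = "weighted_square n q a" and ?G = "tail_product n a"
  \<comment> \<open>The Hecke-type relation q^2 = 1 + q \<omega>, in a form suited to
    rewriting.\<close>
  have qw: "q * (q * z) = z + q * (w * z)" for z using q by (simp add: w_def algebra_simps)
  have s: "?s i k = (if i < k then w else if i = k then q else 0)" for i k
    by (simp add: braid_coeff_def w_def)
  have W: "?W b i k = q * a i b * a b k + w * ?G b i k" if "b \<in> ?I" for b i k
    using weighted_square_eq[OF that] by (simp add: w_def)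
  have W_off: "?W b i k = q * a i b * a b k + w * (a i k * ((if b < i then a i i else 0) + (if b < k then a k k else 0)))"
    if "b \<in> ?I" "i \<in> ?I" "k \<in> ?I" "i \<noteq> k" for b i k
    using W[OF that(1), of i k] tail_product_off_diagonal[of n i k a b] path that by auto
  have hi: "a k k * a i k = 0" "a k k * a k i = 0" if "i \<in> ?I" "k \<in> ?I" "i < k" for i k
    using diag_upper[of i k k] diag_upper[of k i k] that by auto
  have W_left: "?W i i k = (if i < k then q * a i i * a i k else 0)" if "i \<in> ?I" "k \<in> ?I" "i \<noteq> k" for i k
    using W_off[of i i k] hi[of i k] hi[of k i] that by (auto simp: algebra_simps)
  have W_right: "?W k i k = (if k < i then q * a i k * a k k else 0)" if "i \<in> ?I" "k \<in> ?I" "i \<noteq> k" for i k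
    using W_off[of k i k] hi[of i k] hi[of k i] that by (auto simp: algebra_simps)
  have W_mid: "(?s i k - ?s k m) * a k k * a i m + ?W k i m = 0"
    if I: "i \<in> ?I" "k \<in> ?I" "m \<in> ?I" and d: "i \<noteq> k" "i \<noteq> m" "k \<noteq> m" for i k m
  proof (cases "a i m = 0")
    case True
    then show ?thesis using W_off[of k i m] path[OF I d(1,2,3)] I d by simp
  next
    case False
    have top: "a (max i m) (max i m) = 0"
      using diag_upper[of i m "max i m"] I d False by auto
    have W': "?W k i m = w * (a i m * ((if k < i then a i i else 0) + (if k < m then a m m else 0)))"
      using W_off[of k i m] path[OF I d] I d by simp
    consider "k < min i m" | "k > max i m" | "i < k" "k < m" | "m < k" "k < i"
      using d by linarith
    then show ?thesis
    proof cases
      case 1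
      then have "a k k = a i i + a m m"
        using diag_lower[of i m k] I d False top by (auto simp: max_def min_def split: if_splits)
      with 1 show ?thesis unfolding W' by (simp add: s)
    next
      case 2
      then have "a k k = 0" using diag_upper[of i m k] I d False by auto
      with 2 show ?thesis unfolding W' by (simp add: s)
    qed (use top in \<open>auto simp: W' s\<close>)
  qed
  have W_between: "?W k i m = 0" if I: "i \<in> ?I" "k \<in> ?I" "m \<in> ?I" and d: "i < k \<and> k < m \<or> m < k \<and> k < i" for i k m
    using W_mid[OF I] d by (auto simp: s)
  \<comment> \<open>This is the equation at \<open>(i, k, k, i)\<close>. Since
    \<open>quadratic\<close> speaks of ordered pairs only, the two orders are treated
    separately.\<close>
  have W_swap: "?s i k * a k k * a i i + ?W k i i = ?s k i * a k k * a i i + ?W i k k"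
    if "i \<in> ?I" "k \<in> ?I" "i \<noteq> k" for i k
  proof -
    have "w * (?G k i i - ?G i k k) = (?s k i - ?s i k) * (a i i * a k k)"
    proof (cases "i < k")
      case True
      then have "?G k i i - ?G i k k = - (a i i * a k k)"
        using quadratic[of i k] that by (simp add: eq_neg_iff_add_eq_0)
      then show ?thesis using True by (simp add: s)
    next
      case False
      then have "?G k i i - ?G i k k = a i i * a k k"
        using quadratic[of k i] that by (simp add: algebra_simps)
      then show ?thesis using False that by (simp add: s)
    qed
    then show ?thesis using W that by (simp add: algebra_simps)
  qed
  show ?thesis
    unfolding reflection_entries_def
  proof (intro ballI)
    fix i k l m assume I: "i \<in> ?I" "k \<in> ?I" "l \<in> ?I" "m \<in> ?I"
    let ?goal = "?s i k * (if i = l then ?W i k m else a k l * a i m) +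
       (if i = k then 0 else if k = l then ?W k i m else a i l * a k m) =
       ?s l m * (if i = l then ?W i k m else a k l * a i m) +
       (if l = m then 0 else if i = m then ?W i k l else a i l * a k m)"
    \<comment> \<open>The cases follow the conditionals in the equation: which of
      \<open>i = l\<close>, \<open>i = k\<close>, \<open>k = l\<close>, \<open>l = m\<close>,
      \<open>i = m\<close> hold.\<close>
    consider "i = l" "i = k" | "i = l" "i \<noteq> k" "i = m" | "i = l" "i \<noteq> k" "i \<noteq> m"
      | "i \<noteq> l" "i = k" "l = m" | "i \<noteq> l" "i = k" "i = m" | "i \<noteq> l" "i = k" "l \<noteq> m" "i \<noteq> m"
      | "i \<noteq> k" "k = l" "k = m" | "i \<noteq> k" "k = l" "i = m" | "i \<noteq> k" "k = l" "k \<noteq> m" "i \<noteq> m"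
      | "i \<noteq> l" "i \<noteq> k" "k \<noteq> l" "l = m" | "i \<noteq> l" "i \<noteq> k" "k \<noteq> l" "i = m"
      | "i \<noteq> l" "i \<noteq> k" "k \<noteq> l" "l \<noteq> m" "i \<noteq> m"
      by blast
    then show ?goal
    proof cases
      case 1
      then show ?thesis using W_left[of i m] I hi[of m i] qw[of "a i i * a i m"] by (auto simp: s algebra_simps)
    next
      case 2
      then show ?thesis using W_right[of k i] I hi[of k i] qw[of "a k i * a i i"] by (auto simp: s algebra_simps)
    next
      case 3
      then show ?thesis using W_between[of k i m] I by (auto simp: s)
    next
      case 4
      then show ?thesis by (simp add: s)
    next
      case 5
      then show ?thesis using W_left[of i l] I hi[of l i] by (auto simp: s algebra_simps)
    next
      case 6
      then show ?thesis using row[of i l m] I by (auto simp: s)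
    next
      case 7
      then show ?thesis using W_right[of i k] I hi[of i k] by (auto simp: s algebra_simps)
    next
      case 8
      then show ?thesis using W_swap[of i k] I by (auto simp: mult.assoc)
    next
      case 9
      then show ?thesis using W_mid[of i k m] path[of i k m] I by (auto simp: algebra_simps)
    next
      case 10
      then show ?thesis using col[of i k l] I by auto
    next
      case 11
      \<comment> \<open>For distinct indices the two coefficients \<open>?s i k\<close> and
        \<open>?s k i\<close> add up to \<omega>.\<close>
      have eq: "?s k i - ?s i l = ?s l i - ?s i k" using 11 by (auto simp: s)
      have "(?s l i - ?s i k) * a i i * a k l + ?W i k l = 0"
        using W_mid[of k i l] 11 I unfolding eq by simp
      then show ?thesis using 11 path[of k i l] I by (auto simp: algebra_simps)
    next
      case 12
      \<comment> \<open>The coefficients differ only if \<open>i, k\<close> and \<open>l, m\<close>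
        are ordered oppositely, and then \<open>antitone\<close> kills the product.\<close>
      have "(?s i k - ?s l m) * (a k l * a i m) = 0"
      proof (cases "i < k \<longleftrightarrow> l < m")
        case True
        then have "?s i k = ?s l m" using 12 by (simp add: s)
        then show ?thesis by simp
      next
        case False
        then consider "i < k" "m < l" | "k < i" "l < m" using 12 by linarith
        then have "a k l * a i m = 0"
          using antitone[of i k m l] antitone[of k i l m] 12 I by cases (auto simp: mult.commute)
        then show ?thesis by simp
      qed
      then show ?thesis using 12 by (auto simp: algebra_simps)
    qed
  qed
qed

section \<open>Classification of the data\<close>

text \<open>The value 0 outside 2-cycles allows formulas uniform in \<open>i\<close> and makes the
  arbitrary values of \<sigma> off \<open>Y\<close> harmless.\<close>

definition cycle_weight :: "nat set \<Rightarrow> (nat \<Rightarrow> nat) \<Rightarrow> (nat \<Rightarrow> complex) \<Rightarrow> nat \<Rightarrow> complex" where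
  "cycle_weight Y \<sigma> y i = (if i \<in> Y \<and> \<sigma> i \<in> Y then y i * y (\<sigma> i) else 0)"

text \<open>The pattern rewritten in terms of the data, as a common description of both types. The
  condition \<open>weights\<close> is \<open>quadratic\<close> with its tail products
  evaluated.\<close>

locale compatible_data =
  fixes n :: nat and Y :: "nat set" and \<sigma> :: "nat \<Rightarrow> nat" and x y :: "nat \<Rightarrow> complex"
  assumes admissible: "admissible_pair n Y \<sigma>"
    and y_nonzero: "k \<in> Y \<Longrightarrow> y k \<noteq> 0"
    and involutive: "k \<in> Y \<Longrightarrow> \<sigma> k \<in> Y \<Longrightarrow> \<sigma> (\<sigma> k) = k"
    and x_upper: "\<lbrakk>k \<in> Y; max k (\<sigma> k) \<le> b; b \<le> n\<rbrakk> \<Longrightarrow> x b = 0"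
    and x_lower: "\<lbrakk>k \<in> Y; 1 \<le> b; b \<le> min k (\<sigma> k)\<rbrakk> \<Longrightarrow> x b = x (min k (\<sigma> k))"
    and weights: "\<lbrakk>i \<in> {1..n}; j \<in> {1..n}; i < j\<rbrakk> \<Longrightarrow>
      (if j < \<sigma> i then cycle_weight Y \<sigma> y i else 0) - (if i < \<sigma> j then cycle_weight Y \<sigma> y j else 0) +
      x j * (x i - x j) = 0"

lemma admissible_pairD:
  assumes "admissible_pair n Y \<sigma>"
  shows "k \<in> Y \<Longrightarrow> k \<in> {1..n}" "k \<in> Y \<Longrightarrow> \<sigma> k \<in> {1..n}" "k \<in> Y \<Longrightarrow> \<sigma> k \<noteq> k"
    and "\<lbrakk>k \<in> Y; l \<in> Y; \<sigma> k = \<sigma> l\<rbrakk> \<Longrightarrow> k = l"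
    and "\<lbrakk>k \<in> Y; l \<in> Y; k < l\<rbrakk> \<Longrightarrow> \<sigma> l < \<sigma> k"
    and "finite Y"
  using assms finite_subset[of Y "{1..n}"]
  by (auto simp: admissible_pair_def inj_on_def monotone_on_def)

text \<open>The smaller element of {k, \<sigma>(k)} is k on \<open>Y_minus\<close> and \<sigma>(k)
  on \<open>Y_plus\<close>; the larger one is the other. This form treats both halves of
  \<open>Y\<close> at once.\<close>

lemma
  assumes "admissible_pair n Y \<sigma>"
  shows b_minus_eq_Max: "Y \<noteq> {} \<Longrightarrow> b_minus Y \<sigma> = Max ((\<lambda>k. min k (\<sigma> k)) ` Y)"
    and b_plus_eq_Min: "Y \<noteq> {} \<Longrightarrow> b_plus n Y \<sigma> = Min ((\<lambda>k. max k (\<sigma> k)) ` Y)"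
proof -
  have "Y_minus Y \<sigma> \<union> \<sigma> ` Y_plus Y \<sigma> = (\<lambda>k. min k (\<sigma> k)) ` Y"
    "Y_plus Y \<sigma> \<union> \<sigma> ` Y_minus Y \<sigma> = (\<lambda>k. max k (\<sigma> k)) ` Y"
    using admissible_pairD(3)[OF assms]
    by (force simp: Y_minus_def Y_plus_def image_iff min_def max_def)+
  then show "Y \<noteq> {} \<Longrightarrow> b_minus Y \<sigma> = Max ((\<lambda>k. min k (\<sigma> k)) ` Y)"
    "Y \<noteq> {} \<Longrightarrow> b_plus n Y \<sigma> = Min ((\<lambda>k. max k (\<sigma> k)) ` Y)"
    by (simp_all add: b_minus_def b_plus_def)
qed

lemma b_minus_le_iff:
  assumes "admissible_pair n Y \<sigma>"
  shows "b_minus Y \<sigma> \<le> b \<longleftrightarrow> (\<forall>k\<in>Y. min k (\<sigma> k) \<le> b)"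
proof (cases "Y = {}")
  case False
  then show ?thesis
    using b_minus_eq_Max[OF assms False] admissible_pairD(6)[OF assms] by (simp del: min_le_iff_disj)
qed (simp add: b_minus_def)

text \<open>The extra clause for empty \<open>Y\<close> encodes the convention b_+ = n + 1.\<close>

lemma less_b_plus_iff:
  assumes "admissible_pair n Y \<sigma>"
  shows "b < b_plus n Y \<sigma> \<longleftrightarrow> (\<forall>k\<in>Y. b < max k (\<sigma> k)) \<and> (Y = {} \<longrightarrow> b \<le> n)"
proof (cases "Y = {}")
  case False
  then show ?thesis
    using b_plus_eq_Min[OF assms False] admissible_pairD(6)[OF assms] by (simp del: less_max_iff_disj)
qed (auto simp: b_plus_def)

section \<open>Both types give compatible data\<close>

lemma compatible_data_if_type1:
  assumes "data_type1 n Y \<sigma> x y"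
  shows "compatible_data n Y \<sigma> x y"
proof -
  from assms obtain bm bp l m where adm: "admissible_pair n Y \<sigma>"
    and b: "0 < bm" "0 < bp" "bm < bp" "bm + bp \<le> n + 1"
    and Y: "Y = {1..bm} \<union> {bp..bp + bm - 1}" and \<sigma>: "\<And>i. i \<in> Y \<Longrightarrow> \<sigma> i = bp + bm - i"
    and x: "\<And>i. i \<in> {1..bm} \<Longrightarrow> x i = l + m" "\<And>i. i \<in> {bm<..<bp} \<Longrightarrow> x i = l"
      "\<And>i. i \<in> {bp..n} \<Longrightarrow> x i = 0"
    and y: "\<And>i. i \<in> Y \<Longrightarrow> y i * y (\<sigma> i) = - (l * m) \<and> - (l * m) \<noteq> 0"
    unfolding data_type1_def by blast
  have \<sigma>Y: "\<sigma> k \<in> Y" if "k \<in> Y" for k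
    using that b unfolding \<sigma>[OF that] by (auto simp: Y)
  have P: "cycle_weight Y \<sigma> y i = (if i \<in> Y then - (l * m) else 0)" for i
    using \<sigma>Y y by (auto simp: cycle_weight_def)
  show ?thesis
  proof
    show "admissible_pair n Y \<sigma>" by (fact adm)
    fix k assume k: "k \<in> Y"
    show "y k \<noteq> 0" using y[OF k] by auto
    show "\<sigma> (\<sigma> k) = k"
      using \<sigma>[OF \<sigma>Y[OF k]] \<sigma>[OF k] k b by (auto simp: Y)
    have mm: "min k (\<sigma> k) \<le> bm" "bp \<le> max k (\<sigma> k)"
      using k b unfolding \<sigma>[OF k] by (auto simp: Y)
    show "x b = 0" if "max k (\<sigma> k) \<le> b" "b \<le> n" for b
      using mm that by (intro x(3)) auto
    have "1 \<le> min k (\<sigma> k)" using admissible_pairD(1,2)[OF adm k] by simp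
    then show "x b = x (min k (\<sigma> k))" if "1 \<le> b" "b \<le> min k (\<sigma> k)" for b
      using mm that by (subst (1 2) x(1)) auto
  next
    fix i j assume I: "i \<in> {1..n}" "j \<in> {1..n}" "i < j"
    consider "j \<le> bm" | "i \<le> bm" "bm < j" "j < bp" | "i \<le> bm" "bp \<le> j" | "bm < i" "j < bp" | "bm < i" "bp \<le> j"
      by linarith
    then show "(if j < \<sigma> i then cycle_weight Y \<sigma> y i else 0) - (if i < \<sigma> j then cycle_weight Y \<sigma> y j else 0) +
      x j * (x i - x j) = 0"
    proof cases
      case 1
      then have "i \<in> Y" "j \<in> Y" using I by (auto simp: Y)
      then show ?thesis using 1 I b \<sigma> x by (simp add: P)
    next
      case 2
      then have "i \<in> Y" "j \<notin> Y" using I by (auto simp: Y)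
      \<comment> \<open>The weight of \<open>i\<close> is \<open>- (l * m)\<close>, while
        \<open>x j = l\<close> and \<open>x i - x j = m\<close>.\<close>
      then show ?thesis using 2 I b \<sigma> x by (simp add: P algebra_simps)
    next
      case 3
      then have "i \<in> Y" "x j = 0" using I x by (auto simp: Y)
      \<comment> \<open>For \<open>j\<close> in \<open>Y\<close> both inequalities say
        \<open>i + j < bp + bm\<close>; for \<open>j\<close> outside \<open>Y\<close>,
        \<open>j\<close> lies beyond \<open>bp + bm - 1\<close> and hence beyond every value of
        \<sigma>.\<close>
      moreover have "j < \<sigma> i \<longleftrightarrow> j \<in> Y \<and> i < \<sigma> j"
      proof (cases "j \<in> Y")
        case True
        then show ?thesis using \<open>i \<in> Y\<close> \<sigma> I by auto
      next
        case False
        then show ?thesis using \<open>i \<in> Y\<close> 3 \<sigma> I by (auto simp: Y)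
      qed
      ultimately show ?thesis by (auto simp: P)
    next
      case 4
      then have "i \<notin> Y" "j \<notin> Y" using I by (auto simp: Y)
      then show ?thesis using 4 I x by (simp add: P)
    next
      case 5
      then have "x j = 0" "i \<in> Y \<Longrightarrow> \<sigma> i < j" "j \<in> Y \<Longrightarrow> \<sigma> j < i" using I x b \<sigma> by (auto simp: Y)
      then show ?thesis by (auto simp: P)
    qed
  qed
qed

lemma compatible_data_if_type2:
  assumes "data_type2 n Y \<sigma> x y"
  shows "compatible_data n Y \<sigma> x y"
proof -
  from assms obtain b l where adm: "admissible_pair n Y \<sigma>" and disj: "Y \<inter> \<sigma> ` Y = {}"
    and b: "b_minus Y \<sigma> \<le> b" "b < b_plus n Y \<sigma>"
    and x: "\<And>i. i \<in> {1..b} \<Longrightarrow> x i = l" "\<And>i. i \<in> {b<..n} \<Longrightarrow> x i = 0"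
    and y: "\<And>i. i \<in> Y \<Longrightarrow> y i \<noteq> 0"
    unfolding data_type2_def by auto
  have P: "cycle_weight Y \<sigma> y i = 0" for i
    using disj by (auto simp: cycle_weight_def)
  show ?thesis
  proof
    fix k assume k: "k \<in> Y"
    have mm: "min k (\<sigma> k) \<le> b" "b < max k (\<sigma> k)"
      using b k b_minus_le_iff[OF adm] less_b_plus_iff[OF adm] by blast+
    show "x c = 0" if "max k (\<sigma> k) \<le> c" "c \<le> n" for c
      using mm that by (intro x(2)) auto
    have "1 \<le> min k (\<sigma> k)" using admissible_pairD(1,2)[OF adm k] by simp
    then show "x c = x (min k (\<sigma> k))" if "1 \<le> c" "c \<le> min k (\<sigma> k)" for c
      using mm that by (subst (1 2) x(1)) auto
  next
    fix i j assume "i \<in> {1..n}" "j \<in> {1..n}" "i < j"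
    then have "x j * (x i - x j) = 0" using x by (cases "j \<le> b") auto
    then show "(if j < \<sigma> i then cycle_weight Y \<sigma> y i else 0) - (if i < \<sigma> j then cycle_weight Y \<sigma> y j else 0) +
      x j * (x i - x j) = 0" by (simp add: P)
  qed (use adm y disj in auto)
qed

section \<open>Compatible data belong to one of the two types\<close>

context compatible_data
begin

lemma data_type2_if_no_cycle:
  assumes disj: "Y \<inter> \<sigma> ` Y = {}"
  shows "data_type2 n Y \<sigma> x y"
proof -
  have P: "cycle_weight Y \<sigma> y i = 0" for i
    using disj by (auto simp: cycle_weight_def)
  have step: "x j * (x i - x j) = 0" if "i \<in> {1..n}" "j \<in> {1..n}" "i < j" for i j
    using weights[OF that] unfolding P by simp
  have "\<exists>b\<in>{b_minus Y \<sigma>..<b_plus n Y \<sigma>}. \<exists>l. (\<forall>i\<in>{1..b}. x i = l) \<and> (\<forall>i\<in>{b<..n}. x i = 0)"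
  \<comment> \<open>If the diagonal is zero, \<open>b_minus\<close> serves as b; otherwise b is the
    last index with a nonzero diagonal entry.\<close>
  proof (cases "\<forall>i\<in>{1..n}. x i = 0")
    case True
    have "b_minus Y \<sigma> \<le> n"
      unfolding b_minus_le_iff[OF admissible] using admissible_pairD(1)[OF admissible] by fastforce
    then show ?thesis
      using True b_minus_less_b_plus[OF admissible]
      by (intro bexI[of _ "b_minus Y \<sigma>"] exI[of _ 0]) auto
  next
    case False
    define b where "b = Max {i \<in> {1..n}. x i \<noteq> 0}"
    have b: "b \<in> {i \<in> {1..n}. x i \<noteq> 0}"
      unfolding b_def using False by (intro Max_in) auto
    have above: "x i = 0" if "i \<in> {b<..n}" for i
    proof (rule ccontr)
      assume "x i \<noteq> 0"
      then have "i \<le> b" unfolding b_def using that b by (intro Max_ge) auto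
      with that show False by simp
    qed
    have below: "x i = x b" if "i \<in> {1..b}" for i
      using step[of i b] that b by (cases "i = b") auto
    have "min k (\<sigma> k) \<le> b" "b < max k (\<sigma> k)" if k: "k \<in> Y" for k
    proof -
      have "1 \<le> min k (\<sigma> k)" "min k (\<sigma> k) \<le> n" using admissible_pairD(1,2)[OF admissible k] by auto
      \<comment> \<open>The diagonal is constant from 1 up to this minimum, and its value at 1 is
        \<open>x b\<close>.\<close>
      then have "x (min k (\<sigma> k)) \<noteq> 0" using x_lower[OF k, of 1] below[of 1] b by auto
      then show "min k (\<sigma> k) \<le> b"
        using above[of "min k (\<sigma> k)"] \<open>min k (\<sigma> k) \<le> n\<close> by (meson greaterThanAtMost_iff not_le_imp_less)
      show "b < max k (\<sigma> k)"
      proof (rule ccontr)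
        assume "\<not> b < max k (\<sigma> k)"
        then have "x b = 0" using b by (intro x_upper[OF k]) auto
        with b show False by simp
      qed
    qed
    then have "b \<in> {b_minus Y \<sigma>..<b_plus n Y \<sigma>}"
      using b by (simp add: b_minus_le_iff[OF admissible] less_b_plus_iff[OF admissible] del: min_le_iff_disj less_max_iff_disj)
    then show ?thesis
      by (intro bexI[of _ b] exI[of _ "x b"] conjI ballI) (rule below above, assumption)+
  qed
  then show ?thesis
    using admissible disj y_nonzero unfolding data_type2_def by blast
qed

lemma data_type1_if_cycle:
  assumes "Y \<inter> \<sigma> ` Y \<noteq> {}"
  shows "data_type1 n Y \<sigma> x y"
proof -
  let ?P = "cycle_weight Y \<sigma> y"
  note adm = admissible_pairD[OF admissible]
  \<comment> \<open>\<open>U\<close> collects the smaller ends of the 2-cycles; as \<sigma>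
    decreases, the largest of them belongs to the innermost cycle.\<close>
  define U where "U = {u \<in> Y. u < \<sigma> u \<and> \<sigma> u \<in> Y}"
  define u where "u = Max U"
  define v where "v = \<sigma> u"
  have min_U: "min k (\<sigma> k) \<in> U" if "k \<in> Y" "\<sigma> k \<in> Y" for k
    using involutive[OF that] that adm(3)[OF that(1)] by (auto simp: U_def min_def)
  have finU: "finite U" using adm(6) by (simp add: U_def)
  have "u \<in> U"
    unfolding u_def using finU min_U assms by (intro Max_in) auto
  then have u: "u \<in> Y" "u < v" "v \<in> Y" "\<sigma> v = u"
    using involutive by (auto simp: U_def v_def)
  have u_max: "w \<le> u" if "w \<in> U" for w
    unfolding u_def using finU that by (rule Max_ge)
  have uI: "u \<in> {1..n}" and vI: "v \<in> {1..n}" using adm(1) u by auto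
  have Pu: "?P u \<noteq> 0" using u y_nonzero by (auto simp: cycle_weight_def v_def)
  have x_low: "x i = x u" if "i \<in> {1..u}" for i
    using x_lower[OF u(1), of i] that u(2) by (simp add: v_def)
  have x_high: "x i = 0" if "i \<in> {v..n}" for i
    using x_upper[OF u(1), of i] that u(2) by (simp add: v_def)
  \<comment> \<open>Since \<open>x i = x u\<close>, the relation for \<open>(i, u)\<close> compares
    weights only; a nonzero weight at \<open>u\<close> forces an equal one at \<open>i\<close>, and
    so a 2-cycle.\<close>
  have low: "i \<in> Y \<and> \<sigma> i \<in> Y \<and> ?P i = ?P u" if i: "i \<in> {1..u}" for i
  proof (cases "i = u")
    case True
    then show ?thesis using u by (simp add: v_def)
  next
    case False
    then have "(if u < \<sigma> i then ?P i else 0) = ?P u"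
      using weights[of i u] x_low[OF i] i uI u(2) by (simp add: v_def split: if_splits)
    then have "?P i = ?P u" using Pu by (auto split: if_splits)
    then show ?thesis using Pu by (auto simp: cycle_weight_def split: if_splits)
  qed
  \<comment> \<open>A cycle through \<open>b\<close> would have its smaller end above
    \<open>u\<close>, because \<open>b < v\<close> gives \<sigma>(b) > u.\<close>
  have mid_P: "?P b = 0" if b: "b \<in> {u<..<v}" for b
  proof (rule ccontr)
    assume "?P b \<noteq> 0"
    then have bY: "b \<in> Y" "\<sigma> b \<in> Y" by (auto simp: cycle_weight_def split: if_splits)
    have "u < \<sigma> b" using adm(5)[of b v] bY u b by simp
    then show False using u_max[OF min_U[OF bY]] b by auto
  qed
  have mid_x: "x b * (x b - x u) = ?P u" if b: "b \<in> {u<..<v}" for b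
    using weights[of u b] mid_P[OF b] b uI vI by (simp add: v_def algebra_simps)
  \<comment> \<open>Such a \<open>k\<close> would have \<sigma>(k) strictly between \<open>u\<close>
    and \<open>v\<close> as well, so the diagonal would vanish at the larger of the two;
    \<open>mid_x\<close> excludes this because the weight of \<open>u\<close> is nonzero.\<close>
  have mid_Y: "k \<notin> Y" if k: "k \<in> {u<..<v}" for k
  proof
    assume kY: "k \<in> Y"
    then have "u < \<sigma> k" "\<sigma> k < v" using adm(5)[of k v] adm(5)[of u k] u k by (auto simp: v_def)
    then have "max k (\<sigma> k) \<in> {u<..<v}" using k by auto
    moreover have "x (max k (\<sigma> k)) = 0" using x_upper[OF kY, of "max k (\<sigma> k)"] adm(1,2)[OF kY] by simp
    ultimately show False using mid_x Pu by fastforce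
  qed
  have high: "\<sigma> k \<in> {1..u} \<and> \<sigma> (\<sigma> k) = k" if k: "k \<in> Y" "v \<le> k" for k
  proof -
    have "\<sigma> k \<in> {1..u}"
      using adm(5)[of v k] adm(2)[of k] k u by (cases "k = v") auto
    then show ?thesis using low involutive k by blast
  qed
  have one: "1 \<in> {1..u}" using uI by auto
  have high_le: "k \<le> \<sigma> 1" if k: "k \<in> Y" "v \<le> k" for k
  proof (cases "\<sigma> k = 1")
    case False
    then have "1 < \<sigma> k" using high[OF k] by auto
    then show ?thesis using adm(5)[of 1 "\<sigma> k"] low[OF one] low[of "\<sigma> k"] high[OF k] by auto
  qed (use high[OF k] in auto)
  \<comment> \<open>A missing \<open>k\<close> has zero diagonal entry and zero weight, so the
    relation for \<open>(1, k)\<close> would make the weight of 1 vanish.\<close>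
  have no_gap: "k \<in> Y" if k: "v \<le> k" "k \<le> \<sigma> 1" for k
  proof (rule ccontr)
    assume kY: "k \<notin> Y"
    have 1: "\<sigma> 1 \<in> Y" "\<sigma> 1 \<le> n" using low[OF one] adm(1)[of "\<sigma> 1"] by auto
    then have "k < \<sigma> 1" "k \<in> {1..n}" "x k = 0"
      using kY k vI x_high[of k] by (auto simp: le_less)
    then have "?P 1 = 0"
      using weights[of 1 k] kY k u(2) uI by (simp add: cycle_weight_def)
    then show False using low[OF one] Pu by simp
  qed
  \<comment> \<open>Descending induction from \<open>u\<close>: each step down raises \<sigma> by
    exactly 1.\<close>
  have sig_low: "\<sigma> i = v + u - i" if "i \<in> {1..u}" for i
  proof -
    have "i \<le> u" "1 \<le> i" using that by auto
    then show ?thesis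
    proof (induction rule: inc_induct)
      case base
      then show ?case by (simp add: v_def)
    next
      case (step i)
      have iY: "i \<in> Y" "\<sigma> i \<in> Y" "Suc i \<in> Y" "\<sigma> (Suc i) \<in> Y"
        using low[of i] low[of "Suc i"] step by auto
      have IH: "\<sigma> (Suc i) = v + u - Suc i" using step by simp
      have lt: "\<sigma> (Suc i) < \<sigma> i" using adm(5)[OF iY(1,3)] by simp
      have "\<sigma> i = Suc (\<sigma> (Suc i))"
      proof (rule ccontr)
        \<comment> \<open>A skipped value would lie in \<open>Y\<close> by \<open>no_gap\<close>,
          and its image would be strictly between \<open>i\<close> and \<open>Suc i\<close>.\<close>
        let ?k = "Suc (\<sigma> (Suc i))"
        assume "\<sigma> i \<noteq> ?k"
        then have k: "?k < \<sigma> i" using lt by simp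
        have "v \<le> ?k" using IH step by simp
        then have kY: "?k \<in> Y" using no_gap[of ?k] k high_le[of "\<sigma> i"] iY by auto
        have "\<sigma> (\<sigma> i) < \<sigma> ?k" "\<sigma> ?k < \<sigma> (\<sigma> (Suc i))"
          using adm(5)[OF kY iY(2)] adm(5)[OF iY(4) kY] k by auto
        then show False using involutive iY by simp
      qed
      then show ?case using IH step by simp
    qed
  qed
  have sig1: "\<sigma> 1 = v + u - 1" using sig_low[OF one] .
  have Y_eq: "Y = {1..u} \<union> {v..v + u - 1}"
  proof (intro equalityI subsetI)
    fix k assume k: "k \<in> Y"
    show "k \<in> {1..u} \<union> {v..v + u - 1}"
      using mid_Y[of k] adm(1)[OF k] high_le[OF k] k sig1
      by (cases "k \<le> u"; cases "v \<le> k") auto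
  next
    fix k assume "k \<in> {1..u} \<union> {v..v + u - 1}"
    then show "k \<in> Y" using low no_gap sig1 by auto
  qed
  have sig: "\<sigma> k = v + u - k" if k: "k \<in> Y" for k
  proof (cases "k \<le> u")
    case True
    then show ?thesis using sig_low adm(1)[OF k] by simp
  next
    case False
    then have "v \<le> k" using k by (auto simp: Y_eq)
    from high[OF k this] have "\<sigma> k \<in> {1..u}" "v + u - \<sigma> k = k"
      using sig_low[of "\<sigma> k"] by auto
    then show ?thesis by auto
  qed
  have "\<sigma> 1 \<le> n" using low[OF one] adm(1)[of "\<sigma> 1"] by auto
  then have bound: "u + v \<le> n + 1" using sig1 by simp
  have yy: "y i * y (\<sigma> i) = ?P u" if i: "i \<in> Y" for i
  proof (cases "i \<le> u")
    case True
    then have "i \<in> {1..u}" using adm(1)[OF i] by simp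
    from low[OF this] show ?thesis by (auto simp: cycle_weight_def)
  next
    case False
    then have "v \<le> i" using i by (auto simp: Y_eq)
    from high[OF i this] have "\<sigma> i \<in> {1..u}" "\<sigma> (\<sigma> i) = i" by auto
    then show ?thesis using low[of "\<sigma> i"] i by (auto simp: cycle_weight_def mult.commute)
  qed
  \<comment> \<open>This \<open>l\<close> is the \<lambda> of Type 1, a root of t^2 - x_u t = P_u,
    where P_u is the weight of \<open>u\<close>. If some index lies between \<open>u\<close> and
    \<open>v\<close>, the diagonal entry there dictates the root.\<close>
  obtain l where l: "l * (l - x u) = ?P u" "\<And>b. b \<in> {u<..<v} \<Longrightarrow> x b = l"
  proof (cases "Suc u < v")
    case True
    have const: "x b = x (Suc u)" if b: "b \<in> {u<..<v}" for b
    proof (cases "b = Suc u")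
      case False
      have "x b * (x (Suc u) - x b) = 0"
        using weights[of "Suc u" b] mid_P[OF b] mid_P[of "Suc u"] b vI False True
        by (simp split: if_splits)
      then show ?thesis using mid_x[OF b] Pu by auto
    qed simp
    show thesis
      by (rule that[OF _ const]) (use mid_x[of "Suc u"] True in auto)
  next
    case False
    \<comment> \<open>With no index between \<open>u\<close> and \<open>v\<close> either root will
      do; \<open>c\<close> is a square root of the discriminant.\<close>
    define c where "c = csqrt ((x u)\<^sup>2 + 4 * ?P u)"
    have "c * c = x u * x u + 4 * ?P u"
      using power2_csqrt[of "(x u)\<^sup>2 + 4 * ?P u"] by (simp add: c_def power2_eq_square)
    then have "(x u + c) / 2 * ((x u + c) / 2 - x u) = ?P u" by (simp add: field_simps)
    then show thesis by (rule that) (use False in auto)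
  qed
  have ex: "\<exists>l m. (\<forall>i\<in>{1..u}. x i = l + m) \<and> (\<forall>i\<in>{u<..<v}. x i = l) \<and> (\<forall>i\<in>{v..n}. x i = 0) \<and>
      (\<forall>i\<in>Y. y i * y (\<sigma> i) = - (l * m) \<and> - (l * m) \<noteq> 0)"
  \<comment> \<open>The choice \<mu> = x_u - \<lambda> turns the equation for \<open>l\<close> into
    P_u = -\<lambda> \<mu>.\<close>
  proof (rule exI[of _ l], rule exI[of _ "x u - l"], intro conjI)
    show "\<forall>i\<in>Y. y i * y (\<sigma> i) = - (l * (x u - l)) \<and> - (l * (x u - l)) \<noteq> 0"
      using yy l(1) Pu by (auto simp: algebra_simps)
    show "\<forall>i\<in>{1..u}. x i = l + (x u - l)"
    proof
      fix i assume "i \<in> {1..u}"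
      from x_low[OF this] show "x i = l + (x u - l)" by simp
    qed
    show "\<forall>i\<in>{u<..<v}. x i = l" using l(2) by blast
    show "\<forall>i\<in>{v..n}. x i = 0" using x_high by blast
  qed
  have pos: "0 < u" "0 < v" using uI vI by auto
  have sig': "\<forall>i\<in>Y. \<sigma> i = v + u - i" using sig by blast
  show ?thesis
    unfolding data_type1_def
    by (rule conjI[OF admissible], rule exI[of _ u], rule exI[of _ v], intro conjI)
      (rule pos u(2) bound Y_eq sig' ex)+
qed

end

section \<open>Passage between matrices and data\<close>

lemma entry_matrix_of_data:
  assumes "Y \<subseteq> {1..n}" "r \<in> {1..n}" "c \<in> {1..n}"
  shows "entry (matrix_of_data n Y \<sigma> x y) r c =
    (if r = c then x r else 0) + (if c \<in> Y \<and> \<sigma> c = r then y c else 0)"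
proof -
  have fin: "finite Y" using assms(1) finite_subset by blast
  have "entry (matrix_of_data n Y \<sigma> x y) r c =
      (\<Sum>i=1..n. x i * entry (mat_unit n i i) r c) + (\<Sum>j\<in>Y. y j * entry (mat_unit n (\<sigma> j) j) r c)"
    unfolding matrix_of_data_def entry_def
    using assms fin mat_sum_carrier[of Y "\<lambda>j. y j \<cdot>\<^sub>m mat_unit n (\<sigma> j) j" n]
    by (subst index_add_mat) (auto simp: index_mat_sum mat_unit_def)
  also have "(\<Sum>i=1..n. x i * entry (mat_unit n i i) r c) = (\<Sum>i=1..n. if i = c then (if r = c then x r else 0) else 0)"
    by (intro sum.cong refl) (use assms in \<open>auto simp: entry_mat_unit\<close>)
  also have "(\<Sum>j\<in>Y. y j * entry (mat_unit n (\<sigma> j) j) r c) = (\<Sum>j\<in>Y. if j = c then (if \<sigma> c = r then y c else 0) else 0)"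
    by (intro sum.cong refl) (use assms in \<open>auto simp: entry_mat_unit\<close>)
  finally show ?thesis using assms fin by simp
qed

lemma matrix_of_data_carrier:
  assumes "finite Y"
  shows "matrix_of_data n Y \<sigma> x y \<in> carrier_mat n n"
  unfolding matrix_of_data_def using assms by (intro add_carrier_mat mat_sum_carrier) auto

lemma mat_eq_iff_entry:
  assumes "A \<in> carrier_mat n n" "B \<in> carrier_mat n n"
  shows "A = B \<longleftrightarrow> (\<forall>i\<in>{1..n}. \<forall>k\<in>{1..n}. entry A i k = entry B i k)"
proof
  assume *: "\<forall>i\<in>{1..n}. \<forall>k\<in>{1..n}. entry A i k = entry B i k"
  show "A = B"
  proof (rule eq_matI)
    fix r c assume "r < dim_row B" "c < dim_col B"
    then show "A $$ (r, c) = B $$ (r, c)"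
      using *[rule_format, of "Suc r" "Suc c"] assms by (simp add: entry_def)
  qed (use assms in auto)
qed auto

text \<open>A closed walk of length two at \<open>i\<close> either stays at \<open>i\<close> or goes
  around the 2-cycle through \<open>i\<close>, so only \<open>e = i\<close> and
  \<open>e = \<sigma> i\<close> contribute.\<close>

lemma tail_product_diagonal:
  assumes adm: "admissible_pair n Y \<sigma>"
    and a: "\<And>i k. i \<in> {1..n} \<Longrightarrow> k \<in> {1..n} \<Longrightarrow>
      a i k = (if i = k then x i else 0) + (if k \<in> Y \<and> \<sigma> k = i then y k else 0)"
    and inv: "\<And>k. k \<in> Y \<Longrightarrow> \<sigma> k \<in> Y \<Longrightarrow> \<sigma> (\<sigma> k) = k"
    and i: "i \<in> {1..n}"
  shows "tail_product n a b i i =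
    (if b < i then x i * x i else 0) + (if b < \<sigma> i then cycle_weight Y \<sigma> y i else 0)"
proof -
  let ?P = "cycle_weight Y \<sigma> y i"
  have "tail_product n a b i i =
      (\<Sum>e\<in>{b<..n}. (if e = i then x i * x i else 0) + (if e = \<sigma> i then ?P else 0))"
    unfolding tail_product_def
  proof (intro sum.cong refl)
    fix e assume "e \<in> {b<..n}"
    then have e: "e \<in> {1..n}" by auto
    show "a i e * a e i = (if e = i then x i * x i else 0) + (if e = \<sigma> i then ?P else 0)"
    proof (cases "e = i")
      case True
      then show ?thesis using a[OF i i] admissible_pairD(3)[OF adm, of i] by (auto simp: cycle_weight_def)
    next
      case False
      then show ?thesis using a[OF i e] a[OF e i] inv[of i] by (auto simp: cycle_weight_def)
    qed
  qed
  also have "\<dots> = (if b < i then x i * x i else 0) + (if b < \<sigma> i then ?P else 0)"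
    using i admissible_pairD(2)[OF adm, of i] by (auto simp: sum.distrib cycle_weight_def)
  finally show ?thesis .
qed

lemma (in compatible_data) pattern:
  assumes a: "\<And>i k. i \<in> {1..n} \<Longrightarrow> k \<in> {1..n} \<Longrightarrow>
      a i k = (if i = k then x i else 0) + (if k \<in> Y \<and> \<sigma> k = i then y k else 0)"
  shows "reflection_pattern n a"
proof -
  note adm = admissible_pairD[OF admissible]
  have off: "k \<in> Y \<and> \<sigma> k = i" if "i \<in> {1..n}" "k \<in> {1..n}" "i \<noteq> k" "a i k \<noteq> 0" for i k
    using a[OF that(1,2)] that by (auto split: if_splits)
  have diag: "a i i = x i" if "i \<in> {1..n}" for i
    using a[OF that that] adm(3)[of i] by auto
  show ?thesis
  proof
    fix i k l assume I: "i \<in> {1..n}" "k \<in> {1..n}" "l \<in> {1..n}" "i \<noteq> k" "i \<noteq> l" "k \<noteq> l"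
    show "a i k * a i l = 0" using off[of i k] off[of i l] adm(4)[of k l] I
      by (cases "a i k = 0"; cases "a i l = 0") auto
    show "a i l * a k l = 0" using off[of i l] off[of k l] I by auto
    show "a i k * a k l = 0" using off[of i k] off[of k l] involutive[of l] I by auto
  next
    fix i j k l assume I: "i \<in> {1..n}" "j \<in> {1..n}" "k \<in> {1..n}" "l \<in> {1..n}" "i < j" "k < l" "i \<noteq> k" "j \<noteq> l"
    show "a i k * a j l = 0" using off[of i k] off[of j l] adm(5)[of k l] I
      by (cases "a i k = 0"; cases "a j l = 0") auto
  next
    fix i k b assume I: "i \<in> {1..n}" "k \<in> {1..n}" "i \<noteq> k" "a i k \<noteq> 0"
    note k = off[OF I]
    show "a b b = 0" if "max i k \<le> b" "b \<le> n"
      using x_upper[of k b] k that I diag[of b] by (auto simp: max.commute)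
    show "a b b = a (min i k) (min i k)" if "1 \<le> b" "b \<le> min i k"
    proof -
      have "min i k \<in> {1..n}" "b \<in> {1..n}" using I that by auto
      then have "a b b = x b" "a (min i k) (min i k) = x (min i k)" by (simp_all only: diag)
      then show ?thesis using x_lower[of k b] k that by (simp add: min.commute)
    qed
  next
    fix i j assume I: "i \<in> {1..n}" "j \<in> {1..n}" "i < j"
    have T: "tail_product n a b c c = (if b < c then x c * x c else 0) + (if b < \<sigma> c then cycle_weight Y \<sigma> y c else 0)"
      if "c \<in> {1..n}" for b c
      using tail_product_diagonal[of n Y \<sigma> a x y c b] admissible a involutive that by blast
    show "tail_product n a j i i - tail_product n a i j j + a i i * a j j = 0"
      using weights[OF I] T[OF I(1), of j] T[OF I(2), of i] diag I by (simp add: algebra_simps)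
  qed
qed

text \<open>The data are read off the matrix: \<open>Y\<close> consists of the columns with a
  nonzero off-diagonal entry, and \<sigma> gives its row. Well-definedness comes from
  \<open>col\<close>, injectivity from \<open>row\<close>, monotonicity from
  \<open>antitone\<close>.\<close>

lemma (in reflection_pattern) obtain_compatible_data:
  obtains Y \<sigma> x y where "compatible_data n Y \<sigma> x y"
    and "\<And>i k. i \<in> {1..n} \<Longrightarrow> k \<in> {1..n} \<Longrightarrow>
      a i k = (if i = k then x i else 0) + (if k \<in> Y \<and> \<sigma> k = i then y k else 0)"
proof -
  define Y where "Y = {k \<in> {1..n}. \<exists>i\<in>{1..n}. i \<noteq> k \<and> a i k \<noteq> 0}"
  define \<sigma> where "\<sigma> = (\<lambda>k. SOME i. i \<in> {1..n} \<and> i \<noteq> k \<and> a i k \<noteq> 0)"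
  define x where "x = (\<lambda>i. a i i)"
  define y where "y = (\<lambda>k. a (\<sigma> k) k)"
  have Y: "k \<in> {1..n}" if "k \<in> Y" for k using that by (simp add: Y_def)
  have \<sigma>: "\<sigma> k \<in> {1..n} \<and> \<sigma> k \<noteq> k \<and> a (\<sigma> k) k \<noteq> 0" if "k \<in> Y" for k
    unfolding \<sigma>_def by (rule someI_ex) (use that in \<open>auto simp: Y_def\<close>)
  have off: "k \<in> Y \<and> \<sigma> k = i" if "i \<in> {1..n}" "k \<in> {1..n}" "i \<noteq> k" "a i k \<noteq> 0" for i k
  proof -
    have "k \<in> Y" using that by (auto simp: Y_def)
    then show ?thesis using \<sigma>[of k] col[of i "\<sigma> k" k] that by auto
  qed
  have ent: "a i k = (if i = k then x i else 0) + (if k \<in> Y \<and> \<sigma> k = i then y k else 0)"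
    if "i \<in> {1..n}" "k \<in> {1..n}" for i k
    using off[of i k] \<sigma>[of k] that by (auto simp: x_def y_def)
  have inj: "k = l" if "k \<in> Y" "l \<in> Y" "\<sigma> k = \<sigma> l" for k l
    using row[of "\<sigma> k" k l] \<sigma>[of k] \<sigma>[of l] Y that by auto
  have adm: "admissible_pair n Y \<sigma>"
    unfolding admissible_pair_def
  proof (intro conjI)
    show "strict_antimono_on Y \<sigma>"
    proof (rule monotone_onI)
      fix k l assume kl: "k \<in> Y" "l \<in> Y" "k < l"
      then have "\<not> \<sigma> k < \<sigma> l" using antitone[of "\<sigma> k" "\<sigma> l" k l] \<sigma>[of k] \<sigma>[of l] Y by auto
      moreover have "\<sigma> k \<noteq> \<sigma> l" using inj kl by blast
      ultimately show "\<sigma> k > \<sigma> l" by simp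
    qed
  qed (use Y \<sigma> inj in \<open>auto simp: inj_on_def\<close>)
  \<comment> \<open>If \<sigma>(\<sigma>(k)) differed from k, the two arrows would form a path
    through three distinct indices.\<close>
  have inv: "\<sigma> (\<sigma> k) = k" if "k \<in> Y" "\<sigma> k \<in> Y" for k
    using path[of "\<sigma> (\<sigma> k)" "\<sigma> k" k] \<sigma>[OF that(1)] \<sigma>[OF that(2)] Y that by auto
  have "compatible_data n Y \<sigma> x y"
  proof
    fix k assume k: "k \<in> Y"
    show "y k \<noteq> 0" using \<sigma>[OF k] by (simp add: y_def)
    show "x b = 0" if "max k (\<sigma> k) \<le> b" "b \<le> n" for b
      using diag_upper[of "\<sigma> k" k b] \<sigma>[OF k] Y[OF k] that by (auto simp: x_def)
    show "x b = x (min k (\<sigma> k))" if "1 \<le> b" "b \<le> min k (\<sigma> k)" for b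
      using diag_lower[of "\<sigma> k" k b] \<sigma>[OF k] Y[OF k] that by (simp add: x_def min.commute)
  next
    fix i j assume I: "i \<in> {1..n}" "j \<in> {1..n}" "i < j"
    have T: "tail_product n a b c c = (if b < c then x c * x c else 0) + (if b < \<sigma> c then cycle_weight Y \<sigma> y c else 0)"
      if "c \<in> {1..n}" for b c
      using tail_product_diagonal[of n Y \<sigma> a x y c b] adm ent inv that by blast
    show "(if j < \<sigma> i then cycle_weight Y \<sigma> y i else 0) - (if i < \<sigma> j then cycle_weight Y \<sigma> y j else 0) +
        x j * (x i - x j) = 0"
      using quadratic[OF I] T[OF I(1), of j] T[OF I(2), of i] I by (simp add: x_def algebra_simps)
  qed (use adm inv in auto)
  then show thesis using that ent by blast
qed

lemma compatible_data_iff: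
  "compatible_data n Y \<sigma> x y \<longleftrightarrow> data_type1 n Y \<sigma> x y \<or> data_type2 n Y \<sigma> x y"
proof
  assume "compatible_data n Y \<sigma> x y"
  then interpret compatible_data n Y \<sigma> x y .
  show "data_type1 n Y \<sigma> x y \<or> data_type2 n Y \<sigma> x y"
    using data_type1_if_cycle data_type2_if_no_cycle by blast
qed (use compatible_data_if_type1 compatible_data_if_type2 in blast)

theorem theorem2p2:
  fixes n :: nat and q :: complex and A :: "complex mat"
  assumes "n \<ge> 1" and "q \<noteq> 0" and "q ^ 2 \<noteq> 1" and "A \<in> carrier_mat n n"
  shows "reflection_equation n q A \<longleftrightarrow>
    (\<exists>Y \<sigma> x y. A = matrix_of_data n Y \<sigma> x y \<and>
       (data_type1 n Y \<sigma> x y \<or> data_type2 n Y \<sigma> x y))"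
proof -
  \<comment> \<open>Compatibility supplies \<open>Y \<subseteq> {1..n}\<close>, which the entry
    formula for \<open>matrix_of_data\<close> requires.\<close>
  have form: "A = matrix_of_data n Y \<sigma> x y \<longleftrightarrow> (\<forall>i\<in>{1..n}. \<forall>k\<in>{1..n}. entry A i k =
      (if i = k then x i else 0) + (if k \<in> Y \<and> \<sigma> k = i then y k else 0))"
    if "compatible_data n Y \<sigma> x y" for Y \<sigma> x y
  proof -
    have adm: "admissible_pair n Y \<sigma>" using that by (rule compatible_data.admissible)
    then have "Y \<subseteq> {1..n}" "finite Y"
      using admissible_pairD(6)[OF adm] by (auto simp: admissible_pair_def)
    then show ?thesis
      using mat_eq_iff_entry[OF assms(4) matrix_of_data_carrier] by (simp add: entry_matrix_of_data)
  qed
  have "reflection_equation n q A \<longleftrightarrow> reflection_pattern n (entry A)"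
    using reflection_equation_iff_entries[OF assms(4)] reflection_pattern_if_entries[OF assms(2,3)]
      reflection_pattern.entries[OF _ assms(2)] by blast
  also have "\<dots> \<longleftrightarrow> (\<exists>Y \<sigma> x y. A = matrix_of_data n Y \<sigma> x y \<and> compatible_data n Y \<sigma> x y)"
  proof
    assume "reflection_pattern n (entry A)"
    then show "\<exists>Y \<sigma> x y. A = matrix_of_data n Y \<sigma> x y \<and> compatible_data n Y \<sigma> x y"
      using form by (elim reflection_pattern.obtain_compatible_data) blast
  next
    assume "\<exists>Y \<sigma> x y. A = matrix_of_data n Y \<sigma> x y \<and> compatible_data n Y \<sigma> x y"
    then show "reflection_pattern n (entry A)"
      using form compatible_data.pattern by blast
  qed
  finally show ?thesis by (simp only: compatible_data_iff)
qed

end
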